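(* Let $\mathcal{G}$ be an ultragraph, $R$ a field, and $\psi:L_R(\mathcal{G})\rightarrow \mathrm{End}_R(M)$ a perfect permutative representation. Then $\psi$ is irreducible if, and only if, there is $p\in\mathfrak{p}^*\cup\mathfrak{p}^\infty$ such that $M$ is isomorphic to $\mathbb{P}_{[p]}$ via the homomorphism $\Phi:M\to\mathbb{P}$, $\Phi(b_x)=d_{T(x)}$ (that is, $\Phi$ maps $M$ isomorphically onto $\mathbb{P}_{[p]}$).
   Context: An ultragraph is a quadruple $\mathcal{G}=(G^0,\mathcal{G}^1,r,s)$ where $G^0,\mathcal{G}^1$ are countable sets, $s:\mathcal{G}^1\to G^0$ and $r:\mathcal{G}^1\to P(G^0)\setminus\{\emptyset\}$ are maps. $\mathcal{G}^0$ is the smallest subset of $P(G^0)$ containing $\{v\}$ for all $v\in G^0$ and $r(e)$ for all $e\in\mathcal{G}^1$, and closed under finite unions and non-empty finite intersections. A vertex $v$ is a sink if $s^{-1}(v)=\emptyset$; $G^0_s$ is the set of sinks. $L_R(\mathcal{G})$ is the universal (not necessarily unital) $R$-algebra with generators $\{s_e,s_e^*:e\in\mathcal{G}^1\}\cup\{p_A:A\in\mathcal{G}^0\}$ and relations: (1) $p_\emptyset=0$, $p_Ap_B=p_{A\cap B}$, $p_{A\cup B}=p_A+p_B-p_{A\cap B}$ for all $A,B\in\mathcal{G}^0$; (2) $p_{s(e)}s_e=s_ep_{r(e)}=s_e$ and $p_{r(e)}s_e^*=s_e^*p_{s(e)}=s_e^*$ for each $e$; (3) $s_e^*s_f=\delta_{e,f}p_{r(e)}$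 for all $e,f$; (4) $p_v=\sum_{s(e)=v}s_es_e^*$ whenever $0<|s^{-1}(v)|<\infty$ (where $p_v=p_{\{v\}}$). A representation on an $R$-module $M$ is an $R$-algebra homomorphism $L_R(\mathcal{G})\to \mathrm{End}_R(M)$; it is irreducible if $M\ne0$ and the only invariant submodules of $M$ are $0$ and $M$. For a representation $\psi:L_R(\mathcal{G})\to \mathrm{End}_R(M)$, put $M_e=\psi(s_es_e^* )(M)$ for $e\in\mathcal{G}^1$ and $M_A=\psi(p_A)(M)$ for $A\in\mathcal{G}^0$ ($M_v=M_{\{v\}}$). $\psi$ is perfect if $M_v=\bigoplus_{e\in s^{-1}(v)}M_e$ for each non-sink $v$ and $M=\bigoplus_{v\in G^0}M_v$ (internal direct sums). A perfect $\psi$ is permutative if one can choose a basis $B_e$ of $M_e$ for each edge $e$ and a basis $B_v$ of $M_v$ for each sink $v$ such that, setting $B_v=\bigcup_{e\in s^{-1}(v)}B_e$ for each non-sink $v$ and $B_A=\bigcup_{v\in A}B_v$ for $A\in\mathcal{G}^0$, one has $\psi(s_e)(B_{r(e)})=B_e$ for each edge $e$. Fix such bases. $B=\bigcup_{v\in G^0}B_v$ is a basis of $M$; write $B=\{b_x:x\in X\}$ (indexed bijectively by $X$), $B_e=\{b_x:x\in R_e\}$, $B_A=\{b_x:x\in D_A\}$ with $R_e,D_A\subseteq X$ ($D_v=D_{\{v\}}$), and let $g_e:D_{r(e)}\to R_e$ be the bijection with $g_e(x)=y$ iff $\psi(s_e)(b_x)=b_y$. A finite path of length $n\ge1$ is a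 sequence of edges $\alpha=e_1\dots e_n$ with $s(e_{i+1})\in r(e_i)$ for $1\le i\le n-1$; $r(\alpha)=r(e_n)$. An infinite path is a sequence $e_1e_2e_3\dots$ of edges with $s(e_{i+1})\in r(e_i)$ for all $i\ge1$. $\mathfrak{p}^\infty$ is the set of infinite paths, and $\mathfrak{p}^*=\{(\alpha,v):\alpha \text{ a finite path of length}\ge1,\ v\in r(\alpha)\cap G^0_s\}\cup\{(v,v):v\in G^0_s\}$. Elements $\alpha,\beta\in\mathfrak{p}^*\cup\mathfrak{p}^\infty$ are equivalent if either $\alpha,\beta\in\mathfrak{p}^\infty$ and there are $i,j\ge0$ with $\alpha_{i+k}=\beta_{j+k}$ for all $k\ge1$, or $\alpha,\beta\in\mathfrak{p}^*$ with $\alpha=(a,v)$, $\beta=(b,v)$ for the same sink $v$. $[p]$ denotes the equivalence class of $p$. $\mathbb{P}$ is the free $R$-module with basis $\{d_p:p\in\mathfrak{p}^*\cup\mathfrak{p}^\infty\}$ and $\mathbb{P}_{[p]}$ is the submodule generated by $\{d_q:q\in[p]\}$. The map $T:X\to\mathfrak{p}^*\cup\mathfrak{p}^\infty$ is defined as follows. Given $x\in X$, let $v_1$ be the unique vertex with $x\in D_{v_1}$. If $v_1$ is a sink, $T(x)=(v_1,v_1)$. Otherwise let $e_1\in s^{-1}(v_1)$ be the unique edge with $x\in R_{e_1}$, and let $v_2\in r(e_1)$ be the unique vertex with $g_{e_1}^{-1}(x)\in D_{v_2}$. If $v_2$ is a sink, $T(x)=(e_1,v_2)$; otherwise let $e_2\in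 s^{-1}(v_2)$ be the unique edge with $g_{e_1}^{-1}(x)\in R_{e_2}$, and let $v_3\in r(e_2)$ be the unique vertex with $g_{e_2}^{-1}(g_{e_1}^{-1}(x))\in D_{v_3}$. Proceeding recursively, $T(x)=(e_1\dots e_n,v_{n+1})\in\mathfrak{p}^*$ if a sink $v_{n+1}$ is reached, and $T(x)=e_1e_2e_3\dots\in\mathfrak{p}^\infty$ otherwise. $\Phi:M\to\mathbb{P}$ is the $R$-linear map determined by $\Phi(b_x)=d_{T(x)}$ for $x\in X$. (Equivalently $\Phi=\Psi\circ U$, where $M(X)$ is the $R$-module of finitely supported maps $X\to R$, $\delta_x$ is the characteristic map of $\{x\}$, $U:M\to M(X)$, $U(b_x)=\delta_x$, and $\Psi:M(X)\to\mathbb{P}$, $\Psi(\delta_x)=d_{T(x)}$.) *)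

theory Defs
  imports Complex_Main "HOL-Library.Countable_Set" "HOL-Library.Poly_Mapping"
begin

section \<open>Ultragraphs\<close>

record ('v, 'e) pre_ultragraph =
  verts :: "'v set"
  edges :: "'e set"
  src :: "'e \<Rightarrow> 'v"
  rng :: "'e \<Rightarrow> 'v set"

definition ultragraph :: "('v, 'e) pre_ultragraph \<Rightarrow> bool" where
  "ultragraph G \<longleftrightarrow> countable (verts G) \<and> countable (edges G) \<and>
     (\<forall>e\<in>edges G. src G e \<in> verts G \<and> rng G e \<subseteq> verts G \<and> rng G e \<noteq> {})"

definition out_edges :: "('v, 'e) pre_ultragraph \<Rightarrow> 'v \<Rightarrow> 'e set" where
  "out_edges G v = {e \<in> edges G. src G e = v}"

definition sinks :: "('v, 'e) pre_ultragraph \<Rightarrow> 'v set" where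
  "sinks G = {v \<in> verts G. out_edges G v = {}}"

text \<open>The family \<open>\<G>\<^sup>0\<close>. The empty set (the empty union) belongs to it, as the relations
  \<open>p\<^sub>\<emptyset> = 0\<close> and \<open>p\<^sub>A p\<^sub>B = p\<^bsub>A \<inter> B\<^esub>\<close> for disjoint \<open>A\<close>, \<open>B\<close> require.\<close>

inductive_set gen_verts :: "('v, 'e) pre_ultragraph \<Rightarrow> 'v set set"
  for G :: "('v, 'e) pre_ultragraph" where
  empty: "{} \<in> gen_verts G"
| vertex: "v \<in> verts G \<Longrightarrow> {v} \<in> gen_verts G"
| range: "e \<in> edges G \<Longrightarrow> rng G e \<in> gen_verts G"
| union: "A \<in> gen_verts G \<Longrightarrow> B \<in> gen_verts G \<Longrightarrow> A \<union> B \<in> gen_verts G"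
| inter: "A \<in> gen_verts G \<Longrightarrow> B \<in> gen_verts G \<Longrightarrow> A \<inter> B \<in> gen_verts G"


section \<open>Non-unital algebras given by generators and relations\<close>

definition pm_scale :: "'r \<Rightarrow> ('a \<Rightarrow>\<^sub>0 'r::comm_ring_1) \<Rightarrow> ('a \<Rightarrow>\<^sub>0 'r)" where
  "pm_scale c f = Poly_Mapping.map (\<lambda>x. c * x) f"

lemma lookup_pm_scale [simp]: "Poly_Mapping.lookup (pm_scale c f) k = c * Poly_Mapping.lookup f k"
  by (simp add: pm_scale_def Poly_Mapping.map.rep_eq when_def)

text \<open>Words form a monoid under concatenation, written additively so that the multiplication of
  \<open>'g fword \<Rightarrow>\<^sub>0 'r\<close> in \<^theory>\<open>HOL-Library.Poly_Mapping\<close> is that of the free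
  unital algebra. Its elements without constant term form the free non-unital algebra.\<close>

datatype 'g fword = Word (letters: "'g list")

instantiation fword :: (type) monoid_add
begin
definition zero_fword :: "'a fword" where "zero_fword = Word []"
definition plus_fword :: "'a fword \<Rightarrow> 'a fword \<Rightarrow> 'a fword" where
  "plus_fword u w = Word (letters u @ letters w)"
instance by standard (auto simp: zero_fword_def plus_fword_def)
end

definition free_alg :: "'g set \<Rightarrow> ('g fword \<Rightarrow>\<^sub>0 'r::comm_ring_1) set" where
  "free_alg S = {f. \<forall>w\<in>Poly_Mapping.keys f. letters w \<noteq> [] \<and> set (letters w) \<subseteq> S}"

definition gen :: "'g \<Rightarrow> ('g fword \<Rightarrow>\<^sub>0 'r::comm_ring_1)" where
  "gen g = Poly_Mapping.single (Word [g]) 1"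

inductive_set rel_ideal :: "'g set \<Rightarrow> ('g fword \<Rightarrow>\<^sub>0 'r::comm_ring_1) set \<Rightarrow> ('g fword \<Rightarrow>\<^sub>0 'r) set"
  for S :: "'g set" and Rel :: "('g fword \<Rightarrow>\<^sub>0 'r::comm_ring_1) set" where
  zero: "0 \<in> rel_ideal S Rel"
| rel: "f \<in> Rel \<Longrightarrow> f \<in> rel_ideal S Rel"
| add: "f \<in> rel_ideal S Rel \<Longrightarrow> h \<in> rel_ideal S Rel \<Longrightarrow> f + h \<in> rel_ideal S Rel"
| scale: "f \<in> rel_ideal S Rel \<Longrightarrow> pm_scale c f \<in> rel_ideal S Rel"
| mult_left: "a \<in> free_alg S \<Longrightarrow> f \<in> rel_ideal S Rel \<Longrightarrow> a * f \<in> rel_ideal S Rel"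
| mult_right: "a \<in> free_alg S \<Longrightarrow> f \<in> rel_ideal S Rel \<Longrightarrow> f * a \<in> rel_ideal S Rel"

definition pres_rel ::
    "'g set \<Rightarrow> ('g fword \<Rightarrow>\<^sub>0 'r::comm_ring_1) set \<Rightarrow> (('g fword \<Rightarrow>\<^sub>0 'r) \<times> ('g fword \<Rightarrow>\<^sub>0 'r)) set" where
  "pres_rel S Rel = {(f, h). f \<in> free_alg S \<and> h \<in> free_alg S \<and> f - h \<in> rel_ideal S Rel}"

definition pres_class ::
    "'g set \<Rightarrow> ('g fword \<Rightarrow>\<^sub>0 'r::comm_ring_1) set \<Rightarrow> ('g fword \<Rightarrow>\<^sub>0 'r) \<Rightarrow> ('g fword \<Rightarrow>\<^sub>0 'r) set" where
  "pres_class S Rel f = pres_rel S Rel `` {f}"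

definition pres_alg ::
    "'g set \<Rightarrow> ('g fword \<Rightarrow>\<^sub>0 'r::comm_ring_1) set \<Rightarrow> ('g fword \<Rightarrow>\<^sub>0 'r) set set" where
  "pres_alg S Rel = free_alg S // pres_rel S Rel"

definition pres_add where
  "pres_add S Rel x y = (\<Union>f\<in>x. \<Union>h\<in>y. pres_class S Rel (f + h))"

definition pres_mult where
  "pres_mult S Rel x y = (\<Union>f\<in>x. \<Union>h\<in>y. pres_class S Rel (f * h))"

definition pres_scale where
  "pres_scale S Rel c x = (\<Union>f\<in>x. pres_class S Rel (pm_scale c f))"

lemma pm_scale_module: "module (pm_scale :: 'r::comm_ring_1 \<Rightarrow> ('a \<Rightarrow>\<^sub>0 'r) \<Rightarrow> _)"
  by standard (auto intro!: poly_mapping_eqI simp: lookup_add algebra_simps)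

lemma pm_scale_vector_space: "vector_space (pm_scale :: 'r::field \<Rightarrow> ('a \<Rightarrow>\<^sub>0 'r) \<Rightarrow> _)"
  by standard (auto intro!: poly_mapping_eqI simp: lookup_add algebra_simps)

lemma pm_scale_minus: "pm_scale (-1) f = - (f :: 'a \<Rightarrow>\<^sub>0 'r::comm_ring_1)"
  by (intro poly_mapping_eqI) simp

lemma pm_scale_diff: "pm_scale c (f - h) = pm_scale c f - (pm_scale c h :: 'a \<Rightarrow>\<^sub>0 'r::comm_ring_1)"
  by (intro poly_mapping_eqI) (simp add: lookup_minus algebra_simps)

lemma rel_ideal_uminus: "f \<in> rel_ideal S Rel \<Longrightarrow> - f \<in> rel_ideal S Rel"
  using rel_ideal.scale[of f S Rel "-1"] by (simp add: pm_scale_minus)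

lemma free_alg_add: "f \<in> free_alg S \<Longrightarrow> h \<in> free_alg S \<Longrightarrow> f + h \<in> free_alg S"
  unfolding free_alg_def using Poly_Mapping.keys_add[of f h] by blast

lemma free_alg_scale: "f \<in> free_alg S \<Longrightarrow> pm_scale c f \<in> free_alg S"
  unfolding free_alg_def by (auto simp: in_keys_iff)

lemma free_alg_mult: "f \<in> free_alg S \<Longrightarrow> h \<in> free_alg S \<Longrightarrow> f * h \<in> free_alg S"
  unfolding free_alg_def using keys_mult[of f h] by (fastforce simp: plus_fword_def)

lemma equiv_pres_rel: "equiv (free_alg S) (pres_rel S Rel)"
proof (rule equivI)
  show "sym (pres_rel S Rel)"
  proof (rule symI)
    fix f h
    assume "(f, h) \<in> pres_rel S Rel"
    then show "(h, f) \<in> pres_rel S Rel"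
      using rel_ideal_uminus[of "f - h" S Rel] by (auto simp: pres_rel_def)
  qed
  show "trans (pres_rel S Rel)"
  proof (rule transI)
    fix f h k
    assume "(f, h) \<in> pres_rel S Rel" "(h, k) \<in> pres_rel S Rel"
    then show "(f, k) \<in> pres_rel S Rel"
      using rel_ideal.add[of "f - h" S Rel "h - k"] by (auto simp: pres_rel_def)
  qed
qed (auto simp: pres_rel_def refl_on_def rel_ideal.zero)

lemma pres_class_eq_iff:
  "f \<in> free_alg S \<Longrightarrow> h \<in> free_alg S \<Longrightarrow>
    pres_class S Rel f = pres_class S Rel h \<longleftrightarrow> f - h \<in> rel_ideal S Rel"
  unfolding pres_class_def using eq_equiv_class_iff[OF equiv_pres_rel, of f S h Rel]
  by (simp add: pres_rel_def)

lemma pres_class_in: "f \<in> free_alg S \<Longrightarrow> pres_class S Rel f \<in> pres_alg S Rel"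
  unfolding pres_alg_def pres_class_def by (rule quotientI)

lemma pres_class_self: "f \<in> free_alg S \<Longrightarrow> f \<in> pres_class S Rel f"
  unfolding pres_class_def by (rule equiv_class_self[OF equiv_pres_rel])

lemma pres_class_memD:
  "f' \<in> pres_class S Rel f \<Longrightarrow> f' \<in> free_alg S \<and> f' - f \<in> rel_ideal S Rel"
  using rel_ideal_uminus[of "f - f'" S Rel] by (auto simp: pres_class_def pres_rel_def)

lemma UN_UN_constI:
  assumes "\<And>f h. f \<in> A \<Longrightarrow> h \<in> B \<Longrightarrow> F f h = C" and "a \<in> A" and "b \<in> B"
  shows "(\<Union>f\<in>A. \<Union>h\<in>B. F f h) = C"
proof -
  have "(\<Union>f\<in>A. \<Union>h\<in>B. F f h) = (\<Union>f\<in>A. \<Union>h\<in>B. C)"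
    by (intro SUP_cong refl assms(1))
  then show ?thesis using assms(2,3) by auto
qed

lemma pres_add_class:
  assumes f: "f \<in> free_alg S" and h: "h \<in> free_alg S"
  shows "pres_add S Rel (pres_class S Rel f) (pres_class S Rel h) = pres_class S Rel (f + h)"
proof -
  have "pres_class S Rel (f' + h') = pres_class S Rel (f + h)"
    if "f' \<in> pres_class S Rel f" "h' \<in> pres_class S Rel h" for f' h'
  proof -
    show ?thesis using pres_class_memD[OF that(1)] pres_class_memD[OF that(2)] f h
      by (simp add: pres_class_eq_iff free_alg_add rel_ideal.add add_diff_add)
  qed
  then show ?thesis unfolding pres_add_def
    by (rule UN_UN_constI) (use f h in \<open>auto intro: pres_class_self\<close>)
qed

lemma pres_mult_class:
  assumes f: "f \<in> free_alg S" and h: "h \<in> free_alg S"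
  shows "pres_mult S Rel (pres_class S Rel f) (pres_class S Rel h) = pres_class S Rel (f * h)"
proof -
  have "pres_class S Rel (f' * h') = pres_class S Rel (f * h)"
    if "f' \<in> pres_class S Rel f" "h' \<in> pres_class S Rel h" for f' h'
  proof -
    note * = pres_class_memD[OF that(1)] pres_class_memD[OF that(2)]
    have "f' * h' - f * h = (f' - f) * h' + f * (h' - h)" by (simp add: algebra_simps)
    then show ?thesis using * f h
      by (simp add: pres_class_eq_iff free_alg_mult rel_ideal.add rel_ideal.mult_left rel_ideal.mult_right)
  qed
  then show ?thesis unfolding pres_mult_def
    by (rule UN_UN_constI) (use f h in \<open>auto intro: pres_class_self\<close>)
qed

lemma pres_scale_class:
  assumes f: "f \<in> free_alg S"
  shows "pres_scale S Rel c (pres_class S Rel f) = pres_class S Rel (pm_scale c f)"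
proof -
  have "pres_class S Rel (pm_scale c f') = pres_class S Rel (pm_scale c f)"
    if "f' \<in> pres_class S Rel f" for f'
    using pres_class_memD[OF that] f
    by (simp add: pres_class_eq_iff free_alg_scale rel_ideal.scale flip: pm_scale_diff)
  then have "pres_scale S Rel c (pres_class S Rel f)
      = (\<Union>f'\<in>pres_class S Rel f. pres_class S Rel (pm_scale c f))"
    unfolding pres_scale_def by (intro SUP_cong refl)
  then show ?thesis using pres_class_self[OF f] by auto
qed


section \<open>The Leavitt path algebra of an ultragraph\<close>

datatype ('v, 'e) lpa_gen = Proj "'v set" | Edge 'e | Ghost 'e

definition lpa_gens :: "('v, 'e) pre_ultragraph \<Rightarrow> ('v, 'e) lpa_gen set" where
  "lpa_gens G = Proj ` gen_verts G \<union> Edge ` edges G \<union> Ghost ` edges G"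

inductive_set lpa_rels :: "('v, 'e) pre_ultragraph \<Rightarrow> (('v, 'e) lpa_gen fword \<Rightarrow>\<^sub>0 'r::comm_ring_1) set"
  for G :: "('v, 'e) pre_ultragraph" where
  proj_empty: "gen (Proj {}) \<in> lpa_rels G"
| proj_inter: "A \<in> gen_verts G \<Longrightarrow> B \<in> gen_verts G \<Longrightarrow>
    gen (Proj A) * gen (Proj B) - gen (Proj (A \<inter> B)) \<in> lpa_rels G"
| proj_union: "A \<in> gen_verts G \<Longrightarrow> B \<in> gen_verts G \<Longrightarrow>
    gen (Proj (A \<union> B)) - (gen (Proj A) + gen (Proj B) - gen (Proj (A \<inter> B))) \<in> lpa_rels G"
| src_edge: "e \<in> edges G \<Longrightarrow> gen (Proj {src G e}) * gen (Edge e) - gen (Edge e) \<in> lpa_rels G"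
| edge_rng: "e \<in> edges G \<Longrightarrow> gen (Edge e) * gen (Proj (rng G e)) - gen (Edge e) \<in> lpa_rels G"
| rng_ghost: "e \<in> edges G \<Longrightarrow> gen (Proj (rng G e)) * gen (Ghost e) - gen (Ghost e) \<in> lpa_rels G"
| ghost_src: "e \<in> edges G \<Longrightarrow> gen (Ghost e) * gen (Proj {src G e}) - gen (Ghost e) \<in> lpa_rels G"
| ghost_edge: "e \<in> edges G \<Longrightarrow> f \<in> edges G \<Longrightarrow>
    gen (Ghost e) * gen (Edge f) - (if e = f then gen (Proj (rng G e)) else 0) \<in> lpa_rels G"
| cuntz_krieger: "v \<in> verts G \<Longrightarrow> finite (out_edges G v) \<Longrightarrow> out_edges G v \<noteq> {} \<Longrightarrow>
    gen (Proj {v}) - (\<Sum>e\<in>out_edges G v. gen (Edge e) * gen (Ghost e)) \<in> lpa_rels G"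

type_synonym ('v, 'e, 'r) lpa_elem = "(('v, 'e) lpa_gen fword \<Rightarrow>\<^sub>0 'r) set"

abbreviation lpa :: "('v, 'e) pre_ultragraph \<Rightarrow> ('v, 'e, 'r::comm_ring_1) lpa_elem set" where
  "lpa G \<equiv> pres_alg (lpa_gens G) (lpa_rels G)"

abbreviation lpa_add where "lpa_add G \<equiv> pres_add (lpa_gens G) (lpa_rels G)"
abbreviation lpa_mult where "lpa_mult G \<equiv> pres_mult (lpa_gens G) (lpa_rels G)"
abbreviation lpa_scale where "lpa_scale G \<equiv> pres_scale (lpa_gens G) (lpa_rels G)"

definition lpa_p :: "('v, 'e) pre_ultragraph \<Rightarrow> 'v set \<Rightarrow> ('v, 'e, 'r::comm_ring_1) lpa_elem" where
  "lpa_p G A = pres_class (lpa_gens G) (lpa_rels G) (gen (Proj A))"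

definition lpa_s :: "('v, 'e) pre_ultragraph \<Rightarrow> 'e \<Rightarrow> ('v, 'e, 'r::comm_ring_1) lpa_elem" where
  "lpa_s G e = pres_class (lpa_gens G) (lpa_rels G) (gen (Edge e))"

definition lpa_s_star :: "('v, 'e) pre_ultragraph \<Rightarrow> 'e \<Rightarrow> ('v, 'e, 'r::comm_ring_1) lpa_elem" where
  "lpa_s_star G e = pres_class (lpa_gens G) (lpa_rels G) (gen (Ghost e))"


section \<open>Representations\<close>

text \<open>The module \<open>M\<close> is the whole type \<open>'m\<close> with scalar multiplication \<open>scale\<close>;
  a representation is only constrained on the elements of the algebra \<open>lpa G\<close>.\<close>

definition lpa_representation ::
    "('v, 'e) pre_ultragraph \<Rightarrow> ('r::field \<Rightarrow> 'm::ab_group_add \<Rightarrow> 'm) \<Rightarrow>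
      (('v, 'e, 'r) lpa_elem \<Rightarrow> 'm \<Rightarrow> 'm) \<Rightarrow> bool" where
  "lpa_representation G scale \<psi> \<longleftrightarrow>
     (\<forall>x\<in>lpa G. Vector_Spaces.linear scale scale (\<psi> x)) \<and>
     (\<forall>x\<in>lpa G. \<forall>y\<in>lpa G. \<psi> (lpa_add G x y) = (\<lambda>m. \<psi> x m + \<psi> y m)) \<and>
     (\<forall>c. \<forall>x\<in>lpa G. \<psi> (lpa_scale G c x) = (\<lambda>m. scale c (\<psi> x m))) \<and>
     (\<forall>x\<in>lpa G. \<forall>y\<in>lpa G. \<psi> (lpa_mult G x y) = \<psi> x \<circ> \<psi> y)"

definition irreducible_representation ::
    "('v, 'e) pre_ultragraph \<Rightarrow> ('r::field \<Rightarrow> 'm::ab_group_add \<Rightarrow> 'm) \<Rightarrow>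
      (('v, 'e, 'r) lpa_elem \<Rightarrow> 'm \<Rightarrow> 'm) \<Rightarrow> bool" where
  "irreducible_representation G scale \<psi> \<longleftrightarrow>
     (UNIV :: 'm set) \<noteq> {0} \<and>
     (\<forall>N. module.subspace scale N \<and> (\<forall>x\<in>lpa G. \<psi> x ` N \<subseteq> N) \<longrightarrow> N = {0} \<or> N = UNIV)"

definition is_basis :: "('r::field \<Rightarrow> 'm::ab_group_add \<Rightarrow> 'm) \<Rightarrow> 'm set \<Rightarrow> 'm set \<Rightarrow> bool" where
  "is_basis scale B N \<longleftrightarrow> \<not> module.dependent scale B \<and> module.span scale B = N"

definition internal_direct_sum ::
    "('r::field \<Rightarrow> 'm::ab_group_add \<Rightarrow> 'm) \<Rightarrow> 'm set \<Rightarrow> 'i set \<Rightarrow> ('i \<Rightarrow> 'm set) \<Rightarrow> bool" where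
  "internal_direct_sum scale N I F \<longleftrightarrow>
     (\<forall>i\<in>I. module.subspace scale (F i)) \<and>
     N = module.span scale (\<Union>i\<in>I. F i) \<and>
     (\<forall>J m. finite J \<and> J \<subseteq> I \<and> (\<forall>j\<in>J. m j \<in> F j) \<and> (\<Sum>j\<in>J. m j) = 0 \<longrightarrow> (\<forall>j\<in>J. m j = 0))"

definition M_edge ::
    "('v, 'e) pre_ultragraph \<Rightarrow> (('v, 'e, 'r::comm_ring_1) lpa_elem \<Rightarrow> 'm \<Rightarrow> 'm) \<Rightarrow> 'e \<Rightarrow> 'm set" where
  "M_edge G \<psi> e = range (\<psi> (lpa_mult G (lpa_s G e) (lpa_s_star G e)))"

definition M_set ::
    "('v, 'e) pre_ultragraph \<Rightarrow> (('v, 'e, 'r::comm_ring_1) lpa_elem \<Rightarrow> 'm \<Rightarrow> 'm) \<Rightarrow> 'v set \<Rightarrow> 'm set" where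
  "M_set G \<psi> A = range (\<psi> (lpa_p G A))"

definition perfect_representation ::
    "('v, 'e) pre_ultragraph \<Rightarrow> ('r::field \<Rightarrow> 'm::ab_group_add \<Rightarrow> 'm) \<Rightarrow>
      (('v, 'e, 'r) lpa_elem \<Rightarrow> 'm \<Rightarrow> 'm) \<Rightarrow> bool" where
  "perfect_representation G scale \<psi> \<longleftrightarrow>
     (\<forall>v\<in>verts G - sinks G.
        internal_direct_sum scale (M_set G \<psi> {v}) (out_edges G v) (M_edge G \<psi>)) \<and>
     internal_direct_sum scale UNIV (verts G) (\<lambda>v. M_set G \<psi> {v})"

text \<open>Bases are chosen for the edges (\<open>Be\<close>) and for the sinks (\<open>Bs\<close>); they
  determine \<open>B\<^sub>v\<close> for every vertex and \<open>B\<^sub>A\<close> for every set of vertices.\<close>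

definition B_vert ::
    "('v, 'e) pre_ultragraph \<Rightarrow> ('e \<Rightarrow> 'm set) \<Rightarrow> ('v \<Rightarrow> 'm set) \<Rightarrow> 'v \<Rightarrow> 'm set" where
  "B_vert G Be Bs v = (if v \<in> sinks G then Bs v else (\<Union>e\<in>out_edges G v. Be e))"

definition B_set ::
    "('v, 'e) pre_ultragraph \<Rightarrow> ('e \<Rightarrow> 'm set) \<Rightarrow> ('v \<Rightarrow> 'm set) \<Rightarrow> 'v set \<Rightarrow> 'm set" where
  "B_set G Be Bs A = (\<Union>v\<in>A. B_vert G Be Bs v)"

definition permutative_bases ::
    "('v, 'e) pre_ultragraph \<Rightarrow> ('r::field \<Rightarrow> 'm::ab_group_add \<Rightarrow> 'm) \<Rightarrow>
      (('v, 'e, 'r) lpa_elem \<Rightarrow> 'm \<Rightarrow> 'm) \<Rightarrow> ('e \<Rightarrow> 'm set) \<Rightarrow> ('v \<Rightarrow> 'm set) \<Rightarrow> bool" where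
  "permutative_bases G scale \<psi> Be Bs \<longleftrightarrow>
     (\<forall>e\<in>edges G. is_basis scale (Be e) (M_edge G \<psi> e)) \<and>
     (\<forall>v\<in>sinks G. is_basis scale (Bs v) (M_set G \<psi> {v})) \<and>
     (\<forall>e\<in>edges G. \<psi> (lpa_s G e) ` B_set G Be Bs (rng G e) = Be e)"


section \<open>Paths\<close>

text \<open>\<open>FinPath \<alpha> v\<close> is the element \<open>(\<alpha>, v)\<close> of \<open>\<pp>\<^sup>*\<close>, with
  \<open>FinPath [] v\<close> standing for \<open>(v, v)\<close>; \<open>InfPath \<alpha>\<close> is the infinite
  path \<open>\<alpha> 0, \<alpha> 1, \<alpha> 2, \<dots>\<close>.\<close>

datatype ('v, 'e) upath = FinPath "'e list" 'v | InfPath "nat \<Rightarrow> 'e"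

definition finite_path :: "('v, 'e) pre_ultragraph \<Rightarrow> 'e list \<Rightarrow> bool" where
  "finite_path G \<alpha> \<longleftrightarrow> \<alpha> \<noteq> [] \<and> set \<alpha> \<subseteq> edges G \<and>
     (\<forall>i. Suc i < length \<alpha> \<longrightarrow> src G (\<alpha> ! Suc i) \<in> rng G (\<alpha> ! i))"

definition infinite_path :: "('v, 'e) pre_ultragraph \<Rightarrow> (nat \<Rightarrow> 'e) \<Rightarrow> bool" where
  "infinite_path G \<alpha> \<longleftrightarrow> (\<forall>i. \<alpha> i \<in> edges G \<and> src G (\<alpha> (Suc i)) \<in> rng G (\<alpha> i))"

definition upaths :: "('v, 'e) pre_ultragraph \<Rightarrow> ('v, 'e) upath set" where
  "upaths G =
     {FinPath \<alpha> v | \<alpha> v. finite_path G \<alpha> \<and> v \<in> rng G (last \<alpha>) \<inter> sinks G} \<union>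
     {FinPath [] v | v. v \<in> sinks G} \<union>
     {InfPath \<alpha> | \<alpha>. infinite_path G \<alpha>}"

fun path_equiv :: "('v, 'e) upath \<Rightarrow> ('v, 'e) upath \<Rightarrow> bool" where
  "path_equiv (InfPath \<alpha>) (InfPath \<beta>) \<longleftrightarrow> (\<exists>i j. \<forall>k. \<alpha> (i + k) = \<beta> (j + k))"
| "path_equiv (FinPath \<alpha> v) (FinPath \<beta> w) \<longleftrightarrow> v = w"
| "path_equiv _ _ \<longleftrightarrow> False"

definition path_class :: "('v, 'e) pre_ultragraph \<Rightarrow> ('v, 'e) upath \<Rightarrow> ('v, 'e) upath set" where
  "path_class G p = {q \<in> upaths G. path_equiv p q}"

text \<open>The free module \<open>\<PP>\<close> on the paths sits inside
  \<open>('v, 'e) upath \<Rightarrow>\<^sub>0 'r\<close>, with scalar multiplication \<^const>\<open>pm_scale\<close>.\<close>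

definition path_basis :: "('v, 'e) upath \<Rightarrow> (('v, 'e) upath \<Rightarrow>\<^sub>0 'r::field)" where
  "path_basis p = Poly_Mapping.single p 1"

definition path_module :: "('v, 'e) pre_ultragraph \<Rightarrow> ('v, 'e) upath \<Rightarrow> (('v, 'e) upath \<Rightarrow>\<^sub>0 'r::field) set" where
  "path_module G p = module.span pm_scale (path_basis ` path_class G p)"


section \<open>The map from basis indices to paths\<close>

context
  fixes G :: "('v, 'e) pre_ultragraph"
    and \<psi> :: "('v, 'e, 'r::field) lpa_elem \<Rightarrow> 'm::ab_group_add \<Rightarrow> 'm"
    and Be :: "'e \<Rightarrow> 'm set" and Bs :: "'v \<Rightarrow> 'm set"
    and X :: "'x set" and b :: "'x \<Rightarrow> 'm"
begin

definition R_idx :: "'e \<Rightarrow> 'x set" where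
  "R_idx e = {x \<in> X. b x \<in> Be e}"

definition D_idx :: "'v set \<Rightarrow> 'x set" where
  "D_idx A = {x \<in> X. b x \<in> B_set G Be Bs A}"

definition g_map :: "'e \<Rightarrow> 'x \<Rightarrow> 'x" where
  "g_map e x = (THE y. y \<in> R_idx e \<and> \<psi> (lpa_s G e) (b x) = b y)"

definition g_inv :: "'e \<Rightarrow> 'x \<Rightarrow> 'x" where
  "g_inv e = the_inv_into (D_idx (rng G e)) (g_map e)"

definition vert_of :: "'x \<Rightarrow> 'v" where
  "vert_of x = (THE v. v \<in> verts G \<and> x \<in> D_idx {v})"

definition edge_of :: "'x \<Rightarrow> 'e" where
  "edge_of x = (THE e. e \<in> out_edges G (vert_of x) \<and> x \<in> R_idx e)"

definition step :: "'x \<Rightarrow> 'x" where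
  "step x = g_inv (edge_of x) x"

text \<open>The \<open>n\<close>-th iterate \<open>(step ^^ n) x\<close> is obtained from \<open>x\<close> by undoing the maps
  \<open>g\<close> of the first \<open>n\<close> edges of \<open>T(x)\<close>.\<close>

definition T_map :: "'x \<Rightarrow> ('v, 'e) upath" where
  "T_map x =
     (if \<exists>n. vert_of ((step ^^ n) x) \<in> sinks G
      then (let n = (LEAST n. vert_of ((step ^^ n) x) \<in> sinks G)
            in FinPath (map (\<lambda>i. edge_of ((step ^^ i) x)) [0..<n]) (vert_of ((step ^^ n) x)))
      else InfPath (\<lambda>i. edge_of ((step ^^ i) x)))"

end

text \<open>\<^const>\<open>vector_space_pair.construct\<close> extends a map on a linearly independent set linearly.\<close>

definition Phi ::
    "('v, 'e) pre_ultragraph \<Rightarrow> ('r::field \<Rightarrow> 'm::ab_group_add \<Rightarrow> 'm) \<Rightarrow>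
      (('v, 'e, 'r) lpa_elem \<Rightarrow> 'm \<Rightarrow> 'm) \<Rightarrow> ('e \<Rightarrow> 'm set) \<Rightarrow> ('v \<Rightarrow> 'm set) \<Rightarrow>
      'x set \<Rightarrow> ('x \<Rightarrow> 'm) \<Rightarrow> 'm \<Rightarrow> (('v, 'e) upath \<Rightarrow>\<^sub>0 'r)" where
  "Phi G scale \<psi> Be Bs X b =
     vector_space_pair.construct scale pm_scale (b ` X)
       (\<lambda>m. path_basis (T_map G \<psi> Be Bs X b (the_inv_into X b m)))"

lemma Phi_determined:
  fixes scale :: "'r::field \<Rightarrow> 'm::ab_group_add \<Rightarrow> 'm" and G :: "('v, 'e) pre_ultragraph"
  assumes "vector_space scale" and "inj_on b X" and "\<not> module.dependent scale (b ` X)"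
  shows "Vector_Spaces.linear scale pm_scale (Phi G scale \<psi> Be Bs X b)"
    and "x \<in> X \<Longrightarrow> Phi G scale \<psi> Be Bs X b (b x) = path_basis (T_map G \<psi> Be Bs X b x)"
proof -
  interpret vector_space_pair scale "pm_scale :: 'r::field \<Rightarrow> (('v, 'e) upath \<Rightarrow>\<^sub>0 'r) \<Rightarrow> (('v, 'e) upath \<Rightarrow>\<^sub>0 'r)"
    using assms(1) pm_scale_vector_space by (simp add: vector_space_pair_def)
  show "Vector_Spaces.linear scale pm_scale (Phi G scale \<psi> Be Bs X b)"
    unfolding Phi_def by (rule linear_construct) fact
  show "Phi G scale \<psi> Be Bs X b (b x) = path_basis (T_map G \<psi> Be Bs X b x)" if "x \<in> X"
    unfolding Phi_def using construct_basis[OF assms(3), of "b x"] that assms(2)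
    by (simp add: the_inv_into_f_f)
qed

end

theory Submission
  imports Defs
begin

text \<open>
  The generators permute the chosen basis of \<open>M\<close> up to annihilation: \<open>p\<^sub>A\<close> fixes
  \<open>b\<^sub>x\<close>, \<open>s\<^sub>e\<close> puts the edge \<open>e\<close> in front of the itinerary \<open>T(x)\<close>,
  \<open>s\<^sub>e\<^sup>*\<close> removes it, or else they kill \<open>b\<^sub>x\<close>. Which of these happens to \<open>b\<^sub>x\<close> can be read off from
  \<open>T(x)\<close>. Moreover two elements of \<open>\<pp>\<^sup>* \<union> \<pp>\<^sup>\<infinity>\<close> are equivalent if and only if they
  have a common tail (\<open>path_equiv_iff_common_tail\<close>), and the operators lead from an
  itinerary to its tails and back.

  Suppose that the representation is irreducible. The basis vectors with itinerary in one class span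
  an invariant subspace (\<open>invariant_span_class\<close>), so only one class \<open>[p]\<close> occurs. All of its
  paths occur (\<open>path_class_realised\<close>), since tails and prolongations of itineraries are
  itineraries. So \<open>\<Phi>\<close> maps onto \<open>\<PP>\<^bsub>[p]\<^esub>\<close>. Its kernel is invariant
  (\<open>invariant_kernel\<close>), because the image of a basis vector under a generator, seen through
  \<open>\<Phi>\<close>, depends on the itinerary only. As no basis vector lies in it, the kernel is zero.

  Conversely, if \<open>\<Phi>\<close> is an isomorphism onto \<open>\<PP>\<^bsub>[p]\<^esub>\<close>, then \<open>T\<close> is
  injective with values in \<open>[p]\<close>. In a nonzero vector of an invariant subspace, with as few
  basis vectors occurring as possible, only one can occur: two different ones have different itineraries,
  and these can be separated by following their common beginning and then applying one
  more generator (\<open>support_of_shrink\<close>). So the subspace contains a basis vector, and moving along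
  a common tail of itineraries reaches all the others (\<open>invariant_path_equiv\<close>).

  Both arguments use only the action on the basis, so they are carried out for abstract branching
  systems. The rest consists in extracting such a system from the algebra: perfection turns the
  chosen bases into a basis of \<open>M\<close>, and the defining relations determine the action.
\<close>


section \<open>Prefixes of paths\<close>

text \<open>Adding an edge in front of a path is meaningful for finite and infinite paths alike. Stating
  everything through it lets most of the later arguments treat both kinds of path at once.\<close>
fun cons_path :: "'e \<Rightarrow> ('v, 'e) upath \<Rightarrow> ('v, 'e) upath" where
  "cons_path e (FinPath \<alpha> v) = FinPath (e # \<alpha>) v"
| "cons_path e (InfPath \<alpha>) = InfPath (case_nat e \<alpha>)"

abbreviation prepend :: "'e list \<Rightarrow> ('v, 'e) upath \<Rightarrow> ('v, 'e) upath" where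
  "prepend \<alpha> p \<equiv> foldr cons_path \<alpha> p"

fun initial_vertex :: "('v, 'e) pre_ultragraph \<Rightarrow> ('v, 'e) upath \<Rightarrow> 'v" where
  "initial_vertex G (FinPath [] v) = v"
| "initial_vertex G (FinPath (e # \<alpha>) v) = src G e"
| "initial_vertex G (InfPath \<alpha>) = src G (\<alpha> 0)"

lemma initial_vertex_cons [simp]: "initial_vertex G (cons_path e p) = src G e"
  by (cases p) auto

lemma case_nat_inject: "case_nat a f = case_nat b g \<longleftrightarrow> a = b \<and> f = g"
proof
  assume *: "case_nat a f = case_nat b g"
  have "f n = g n" for n using fun_cong[OF *, of "Suc n"] by simp
  then show "a = b \<and> f = g" using fun_cong[OF *, of 0] by auto
qed auto

lemma cons_path_inject [simp]: "cons_path e p = cons_path f q \<longleftrightarrow> e = f \<and> p = q"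
  by (cases p; cases q) (auto simp: case_nat_inject)

lemma cons_path_neq_Nil [simp]:
  "cons_path e p \<noteq> FinPath [] v" "FinPath [] v \<noteq> cons_path e p"
  by (cases p; simp)+

lemma finite_path_Cons:
  "finite_path G (e # \<alpha>) \<longleftrightarrow>
     e \<in> edges G \<and> (\<alpha> = [] \<or> (finite_path G \<alpha> \<and> src G (hd \<alpha>) \<in> rng G e))"
proof (cases \<alpha>)
  case (Cons f \<beta>)
  have "(\<forall>i. Suc i < length (e # \<alpha>) \<longrightarrow> src G ((e # \<alpha>) ! Suc i) \<in> rng G ((e # \<alpha>) ! i)) \<longleftrightarrow>
      src G f \<in> rng G e \<and> (\<forall>i. Suc i < length \<alpha> \<longrightarrow> src G (\<alpha> ! Suc i) \<in> rng G (\<alpha> ! i))"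
    unfolding Cons by (auto simp: nth_Cons split: nat.splits)
  then show ?thesis by (auto simp: finite_path_def Cons)
qed (auto simp: finite_path_def)

lemma infinite_path_case_nat:
  "infinite_path G (case_nat e \<alpha>) \<longleftrightarrow>
     e \<in> edges G \<and> infinite_path G \<alpha> \<and> src G (\<alpha> 0) \<in> rng G e"
  unfolding infinite_path_def by (auto split: nat.splits)

lemma FinPath_in_upaths:
  "FinPath \<alpha> v \<in> upaths G \<longleftrightarrow>
     v \<in> sinks G \<and> (\<alpha> = [] \<or> finite_path G \<alpha> \<and> v \<in> rng G (last \<alpha>))"
  by (auto simp: upaths_def finite_path_def)

lemma InfPath_in_upaths: "InfPath \<alpha> \<in> upaths G \<longleftrightarrow> infinite_path G \<alpha>"
  by (auto simp: upaths_def)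

lemma cons_path_in_upaths_iff:
  "cons_path e p \<in> upaths G \<longleftrightarrow>
     e \<in> edges G \<and> p \<in> upaths G \<and> initial_vertex G p \<in> rng G e"
proof (cases p)
  case (FinPath \<alpha> v)
  then show ?thesis
    by (cases \<alpha>) (auto simp: FinPath_in_upaths finite_path_Cons)
qed (auto simp: InfPath_in_upaths infinite_path_case_nat)

lemma prepend_FinPath: "prepend \<alpha> (FinPath \<beta> v) = FinPath (\<alpha> @ \<beta>) v"
  by (induction \<alpha>) auto

text \<open>The prefix occupies the first \<open>length \<alpha>\<close> places, so from there on the sequence is the old one.\<close>
lemma prepend_InfPath:
  "\<exists>\<gamma>. (prepend \<alpha> (InfPath \<beta>) :: ('v, 'e) upath) = InfPath \<gamma> \<and> (\<forall>k. \<gamma> (length \<alpha> + k) = \<beta> k)"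
proof (induction \<alpha>)
  case (Cons e \<alpha>)
  then obtain \<gamma> where "(prepend \<alpha> (InfPath \<beta>) :: ('v, 'e) upath) = InfPath \<gamma>" "\<forall>k. \<gamma> (length \<alpha> + k) = \<beta> k"
    by blast
  then show ?case by (intro exI[of _ "case_nat e \<gamma>"]) simp
qed simp

lemma InfPath_split:
  "(InfPath \<alpha> :: ('v, 'e) upath) = prepend (map \<alpha> [0..<i]) (InfPath (\<lambda>k. \<alpha> (i + k)))"
proof (induction i arbitrary: \<alpha>)
  case (Suc i)
  have "(InfPath \<alpha> :: ('v, 'e) upath) = cons_path (\<alpha> 0) (InfPath (\<lambda>k. \<alpha> (Suc k)))"
    by (auto split: nat.splits)
  also have "(InfPath (\<lambda>k. \<alpha> (Suc k)) :: ('v, 'e) upath) =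
      prepend (map (\<lambda>k. \<alpha> (Suc k)) [0..<i]) (InfPath (\<lambda>k. \<alpha> (Suc i + k)))"
    using Suc[of "\<lambda>k. \<alpha> (Suc k)"] by simp
  also have "map (\<lambda>k. \<alpha> (Suc k)) [0..<i] = map \<alpha> [Suc 0..<Suc i]"
    by (simp only: map_Suc_upt[symmetric] map_map comp_def)
  finally show ?case by (simp only: upt_conv_Cons[OF zero_less_Suc] list.map foldr.simps comp_apply)
qed simp

text \<open>Two elements of \<open>\<pp>\<^sup>*\<close> with the same sink \<open>v\<close> have the tail \<open>(v, v)\<close> in common, and
  two infinite paths that agree after shifts have a common shifted tail; so both clauses of the
  equivalence say the same thing. With this form, a property passes to equivalent paths as soon
  as it passes to a path from its suffixes and conversely, that is, by induction on a list of edges.\<close>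
lemma path_equiv_iff_common_tail:
  "path_equiv p q \<longleftrightarrow> (\<exists>\<alpha> \<beta> r. p = prepend \<alpha> r \<and> q = prepend \<beta> r)"
proof
  assume *: "path_equiv p q"
  show "\<exists>\<alpha> \<beta> r. p = prepend \<alpha> r \<and> q = prepend \<beta> r"
  proof (cases p; cases q)
    fix \<alpha> v \<beta> w assume "p = FinPath \<alpha> v" "q = FinPath \<beta> w"
    with * have "p = prepend \<alpha> (FinPath [] v)" "q = prepend \<beta> (FinPath [] v)"
      by (auto simp: prepend_FinPath)
    then show ?thesis by blast
  next
    fix \<alpha> \<beta> assume pq: "p = InfPath \<alpha>" "q = InfPath \<beta>"
    with * obtain i j where ij: "\<And>k. \<alpha> (i + k) = \<beta> (j + k)" by auto
    have "p = prepend (map \<alpha> [0..<i]) (InfPath (\<lambda>k. \<alpha> (i + k)))"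
      "q = prepend (map \<beta> [0..<j]) (InfPath (\<lambda>k. \<alpha> (i + k)))"
      using InfPath_split[of \<alpha> i] InfPath_split[of \<beta> j] by (simp_all only: pq ij)
    then show ?thesis by blast
  qed (use * in auto)
next
  assume "\<exists>\<alpha> \<beta> r. p = prepend \<alpha> r \<and> q = prepend \<beta> r"
  then obtain \<alpha> \<beta> r where pq: "p = prepend \<alpha> r" "q = prepend \<beta> r" by blast
  show "path_equiv p q"
  proof (cases r)
    case (InfPath \<rho>)
    obtain \<gamma> \<delta> where "p = InfPath \<gamma>" "\<forall>k. \<gamma> (length \<alpha> + k) = \<rho> k"
      "q = InfPath \<delta>" "\<forall>k. \<delta> (length \<beta> + k) = \<rho> k"
      using prepend_InfPath[of \<alpha> \<rho>] prepend_InfPath[of \<beta> \<rho>] pq InfPath by metis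
    then have "p = InfPath \<gamma>" "q = InfPath \<delta>"
      "\<forall>k. \<gamma> (length \<alpha> + k) = \<delta> (length \<beta> + k)" by auto
    then show ?thesis by auto
  qed (use pq in \<open>auto simp: prepend_FinPath\<close>)
qed

lemma path_equiv_refl: "path_equiv p p"
  by (cases p) auto

lemma path_equiv_sym: "path_equiv p q \<Longrightarrow> path_equiv q p"
  by (auto simp: path_equiv_iff_common_tail)

lemma path_equiv_trans:
  assumes "path_equiv p q" "path_equiv q r" shows "path_equiv p r"
proof (cases p; cases q; cases r)
  fix \<alpha> \<beta> \<gamma> assume pqr: "p = InfPath \<alpha>" "q = InfPath \<beta>" "r = InfPath \<gamma>"
  with assms obtain i j i' j' where
    "\<And>k. \<alpha> (i + k) = \<beta> (j + k)" "\<And>k. \<beta> (i' + k) = \<gamma> (j' + k)" by auto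
  then have "\<alpha> ((i + i') + k) = \<gamma> ((j' + j) + k)" for k
    by (metis add.assoc add.left_commute)
  then show ?thesis using pqr by auto
qed (use assms in auto)

lemma path_equiv_cons: "path_equiv (cons_path e p) p"
  unfolding path_equiv_iff_common_tail
  by (intro exI[of _ "[e]"] exI[of _ "[]"] exI[of _ p]) simp


section \<open>Branching systems and itineraries\<close>

text \<open>The combinatorics behind a permutative representation. A point that does not lie over a sink
  carries an edge and a next point; \<open>lift e\<close>, the map \<open>g\<^sub>e\<close>, goes back one step
  along \<open>e\<close>. The itinerary \<open>T\<close> enters only through its two recursion equations:
  they determine it, because the edges of \<open>T x\<close> can be read off one after the other, and
  they are easier to reason with than the iterates of \<open>step\<close>.\<close>
locale branching_system =
  fixes G :: "('v, 'e) pre_ultragraph" and X :: "'x set"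
    and vert :: "'x \<Rightarrow> 'v" and edge :: "'x \<Rightarrow> 'e" and step :: "'x \<Rightarrow> 'x"
    and lift :: "'e \<Rightarrow> 'x \<Rightarrow> 'x" and T :: "'x \<Rightarrow> ('v, 'e) upath"
  assumes vert_in: "x \<in> X \<Longrightarrow> vert x \<in> verts G"
    and edge_in: "x \<in> X \<Longrightarrow> vert x \<notin> sinks G \<Longrightarrow> edge x \<in> edges G"
    and src_edge: "x \<in> X \<Longrightarrow> vert x \<notin> sinks G \<Longrightarrow> src G (edge x) = vert x"
    and step_in: "x \<in> X \<Longrightarrow> vert x \<notin> sinks G \<Longrightarrow> step x \<in> X"
    and vert_step: "x \<in> X \<Longrightarrow> vert x \<notin> sinks G \<Longrightarrow> vert (step x) \<in> rng G (edge x)"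
    and lift_in: "e \<in> edges G \<Longrightarrow> y \<in> X \<Longrightarrow> vert y \<in> rng G e \<Longrightarrow> lift e y \<in> X"
    and lift_not_sink: "e \<in> edges G \<Longrightarrow> y \<in> X \<Longrightarrow> vert y \<in> rng G e \<Longrightarrow> vert (lift e y) \<notin> sinks G"
    and edge_lift: "e \<in> edges G \<Longrightarrow> y \<in> X \<Longrightarrow> vert y \<in> rng G e \<Longrightarrow> edge (lift e y) = e"
    and step_lift: "e \<in> edges G \<Longrightarrow> y \<in> X \<Longrightarrow> vert y \<in> rng G e \<Longrightarrow> step (lift e y) = y"
    and lift_step: "x \<in> X \<Longrightarrow> vert x \<notin> sinks G \<Longrightarrow> lift (edge x) (step x) = x"
    and T_sink: "x \<in> X \<Longrightarrow> vert x \<in> sinks G \<Longrightarrow> T x = FinPath [] (vert x)"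
    and T_cons: "x \<in> X \<Longrightarrow> vert x \<notin> sinks G \<Longrightarrow> T x = cons_path (edge x) (T (step x))"
begin

lemma T_lift:
  "e \<in> edges G \<Longrightarrow> y \<in> X \<Longrightarrow> vert y \<in> rng G e \<Longrightarrow> T (lift e y) = cons_path e (T y)"
  by (simp add: T_cons lift_in lift_not_sink edge_lift step_lift)

text \<open>The path remembers the vertex of its point. Hence points with equal itineraries are treated
  alike by every generator of the algebra.\<close>
lemma initial_vertex_T: "x \<in> X \<Longrightarrow> initial_vertex G (T x) = vert x"
  by (cases "vert x \<in> sinks G") (simp_all add: T_sink T_cons src_edge)

lemma T_eq_cons:
  assumes "x \<in> X" "T x = cons_path e p"
  shows "vert x \<notin> sinks G" "edge x = e" "T (step x) = p"
  using assms T_sink[of x] T_cons[of x] by (metis cons_path_neq_Nil(1) cons_path_inject)+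

lemma T_InfPath:
  assumes "x \<in> X" "T x = InfPath \<alpha>"
  shows "vert x \<notin> sinks G" "\<alpha> 0 = edge x" "T (step x) = InfPath (\<lambda>n. \<alpha> (Suc n))"
proof -
  have "T x = cons_path (\<alpha> 0) (InfPath (\<lambda>n. \<alpha> (Suc n)))"
    using assms(2) by (auto split: nat.splits)
  from T_eq_cons[OF assms(1) this]
  show "vert x \<notin> sinks G" "\<alpha> 0 = edge x" "T (step x) = InfPath (\<lambda>n. \<alpha> (Suc n))" by auto
qed

text \<open>A finite itinerary ends at a sink after finitely many uses of the recursion, so induction on
  its edges works. For an infinite one, every shifted tail is the itinerary of some point of the
  orbit, and consecutive edges fit together there.\<close>
lemma T_in_upaths: "x \<in> X \<Longrightarrow> T x \<in> upaths G"
proof (cases "T x")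
  case (FinPath \<alpha> v)
  assume "x \<in> X"
  with FinPath show ?thesis
  proof (induction \<alpha> arbitrary: x)
    case Nil
    then have "vert x \<in> sinks G" using T_cons[of x] by fastforce
    then show ?case using Nil by (auto simp: T_sink FinPath_in_upaths)
  next
    case (Cons e \<alpha>)
    then have eq: "T x = cons_path e (FinPath \<alpha> v)" by simp
    note * = T_eq_cons[OF Cons.prems(2) eq]
    have "T (step x) \<in> upaths G" using Cons * step_in by metis
    then show ?case unfolding T_cons[OF Cons.prems(2) *(1)] cons_path_in_upaths_iff
      using Cons.prems(2) *(1) by (simp add: edge_in initial_vertex_T step_in vert_step)
  qed
next
  case (InfPath \<alpha>)
  assume x: "x \<in> X"
  have "\<exists>y\<in>X. T y = InfPath (\<lambda>k. \<alpha> (n + k))" for n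
  proof (induction n)
    case (Suc n)
    then show ?case using T_InfPath step_in by fastforce
  qed (use InfPath x in auto)
  then have "\<alpha> n \<in> edges G \<and> src G (\<alpha> (Suc n)) \<in> rng G (\<alpha> n)" for n
  proof -
    assume "\<And>n. \<exists>y\<in>X. T y = InfPath (\<lambda>k. \<alpha> (n + k))"
    then obtain y where y: "y \<in> X" "T y = InfPath (\<lambda>k. \<alpha> (n + k))" by blast
    note * = T_InfPath[OF y]
    have "src G (\<alpha> (Suc n)) = vert (step y)"
      using initial_vertex_T[OF step_in[OF y(1) *(1)]] *(3) by simp
    then show ?thesis using *(2) edge_in[OF y(1) *(1)] vert_step[OF y(1) *(1)] by simp
  qed
  then show ?thesis by (simp add: InfPath InfPath_in_upaths infinite_path_def)
qed

lemma suffix_realised: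
  assumes "x \<in> X" "T x = prepend \<alpha> r"
  shows "\<exists>y\<in>X. T y = r"
  using assms
proof (induction \<alpha> arbitrary: x)
  case (Cons e \<alpha>)
  then show ?case using T_eq_cons[of x e "prepend \<alpha> r"] step_in by auto
qed auto

text \<open>Lifting along the edges of the prefix, last edge first, stays defined precisely because the
  prolonged sequence of edges is again a path.\<close>
lemma prefix_realised:
  assumes "y \<in> X" "T y = r" "prepend \<alpha> r \<in> upaths G"
  shows "\<exists>x\<in>X. T x = prepend \<alpha> r"
  using assms(3)
proof (induction \<alpha>)
  case (Cons e \<alpha>)
  then have e: "e \<in> edges G" "prepend \<alpha> r \<in> upaths G"
    "initial_vertex G (prepend \<alpha> r) \<in> rng G e"
    by (auto simp: cons_path_in_upaths_iff)
  with Cons obtain x where x: "x \<in> X" "T x = prepend \<alpha> r" by auto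
  then have "vert x \<in> rng G e" using e initial_vertex_T by metis
  then show ?case using T_lift[OF e(1) x(1)] lift_in[OF e(1) x(1)] x by auto
qed (use assms in auto)

lemma path_class_realised:
  assumes "x \<in> X" shows "path_class G (T x) \<subseteq> T ` X"
proof
  fix q assume "q \<in> path_class G (T x)"
  then obtain \<alpha> \<beta> r where "q \<in> upaths G" "T x = prepend \<alpha> r" "q = prepend \<beta> r"
    by (auto simp: path_class_def path_equiv_iff_common_tail)
  then show "q \<in> T ` X"
    using suffix_realised[OF assms] prefix_realised by (metis imageI)
qed

text \<open>Two points are separable if some finite number of common steps leads them to points that lie
  over different vertices or choose different edges, so that one generator (\<open>p\<^sub>v\<close> in the first
  case, \<open>s\<^sub>e\<^sup>*\<close> in the second) keeps one of the two basis vectors and kills the other.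
  The \<open>edge\<close> rule mentions a sink for one point only, which is enough: if the other one lies
  over a sink, then the vertices differ.\<close>
inductive separable :: "'x \<Rightarrow> 'x \<Rightarrow> bool" where
  vert: "vert x \<noteq> vert x' \<Longrightarrow> separable x x'"
| edge: "vert x \<notin> sinks G \<Longrightarrow> edge x \<noteq> edge x' \<Longrightarrow> separable x x'"
| step: "vert x \<notin> sinks G \<Longrightarrow> vert x' \<notin> sinks G \<Longrightarrow> edge x = edge x' \<Longrightarrow>
    separable (step x) (step x') \<Longrightarrow> separable x x'"

text \<open>Inseparability is inherited along the orbits, so the two itineraries are read off
  identically. A finite itinerary is followed to its end by induction on its edges; two
  infinite ones are compared place by place.\<close>
lemma not_separable_imp_T_eq:
  assumes "x \<in> X" "x' \<in> X" "\<not> separable x x'"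
  shows "T x = T x'"
proof -
  have descend: "vert x' \<notin> sinks G \<and> edge x' = edge x \<and> step x \<in> X \<and> step x' \<in> X \<and>
      \<not> separable (step x) (step x')"
    if "x \<in> X" "x' \<in> X" "\<not> separable x x'" "vert x \<notin> sinks G" for x x'
    using that separable.intros[of x x'] step_in by metis
  have fin: "T x = T x'"
    if "x \<in> X" "x' \<in> X" "\<not> separable x x'" "T x = FinPath \<alpha> v" for x x' \<alpha> v
    using that
  proof (induction \<alpha> arbitrary: x x')
    case Nil
    then have "vert x \<in> sinks G" using T_cons[of x] by fastforce
    moreover have "vert x = vert x'" using Nil separable.vert by blast
    ultimately show ?case using Nil by (simp add: T_sink)
  next
    case (Cons e \<alpha>)
    then have "T x = cons_path e (FinPath \<alpha> v)" by simp
    note * = T_eq_cons[OF Cons.prems(1) this]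
    note d = descend[OF Cons.prems(1-3) *(1)]
    then have "T (step x) = T (step x')" using Cons.IH * by blast
    then show ?case using T_cons[of x] T_cons[of x'] * d Cons.prems by simp
  qed
  show ?thesis
  proof (cases "T x"; cases "T x'")
    fix \<alpha> \<beta> assume inf: "T x = InfPath \<alpha>" "T x' = InfPath \<beta>"
    have "\<alpha> n = \<beta> n" for n
      using assms inf
    proof (induction n arbitrary: x x' \<alpha> \<beta>)
      case 0
      then show ?case using T_InfPath(1,2) descend by metis
    next
      case (Suc n)
      note * = T_InfPath[OF Suc.prems(1,4)] T_InfPath[OF Suc.prems(2,5)]
      show ?case
        using Suc.IH[OF _ _ _ *(3,6)] descend[OF Suc.prems(1-3) *(1)] by blast
    qed
    then show ?thesis using inf by auto
  next
    fix \<alpha> \<beta> v assume "T x = InfPath \<alpha>" "T x' = FinPath \<beta> v"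
    \<comment> \<open>The finite case applies to the pair in the opposite order.\<close>
    moreover have "\<not> separable x' x"
    proof
      assume "separable x' x"
      then have "separable x x'"
      proof induction
        case (edge x x')
        then show ?case using separable.intros(1,2) by metis
      qed (auto intro: separable.intros)
      then show False using assms by blast
    qed
    ultimately show ?thesis using fin[of x' x] assms by metis
  qed (use fin assms in blast)+
qed

end


section \<open>Irreducibility of a branching representation\<close>

text \<open>A vector space with a basis indexed by the points of a branching system, on which
  \<open>p\<^sub>A\<close>, \<open>s\<^sub>e\<close> and \<open>s\<^sub>e\<^sup>*\<close> (here \<open>proj\<close>, \<open>push\<close> and
  \<open>pull\<close>) permute basis vectors or annihilate them. The relations of the algebra are no longer
  visible: irreducibility depends on these operators alone.\<close>
locale branching_representation =
  branching_system G X vert edge step lift T + vector_space scale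
  for G :: "('v, 'e) pre_ultragraph" and X :: "'x set" and vert edge step lift T
    and scale :: "'r::field \<Rightarrow> 'm::ab_group_add \<Rightarrow> 'm" (infixr "*s" 75) +
  fixes b :: "'x \<Rightarrow> 'm"
    and proj :: "'v set \<Rightarrow> 'm \<Rightarrow> 'm" and push :: "'e \<Rightarrow> 'm \<Rightarrow> 'm" and pull :: "'e \<Rightarrow> 'm \<Rightarrow> 'm"
  assumes inj_b: "inj_on b X"
    and indep_b: "independent (b ` X)"
    and span_b: "span (b ` X) = UNIV"
    and linear_proj: "A \<in> gen_verts G \<Longrightarrow> Vector_Spaces.linear scale scale (proj A)"
    and linear_push: "e \<in> edges G \<Longrightarrow> Vector_Spaces.linear scale scale (push e)"
    and linear_pull: "e \<in> edges G \<Longrightarrow> Vector_Spaces.linear scale scale (pull e)"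
    and proj_b: "A \<in> gen_verts G \<Longrightarrow> x \<in> X \<Longrightarrow> proj A (b x) = (if vert x \<in> A then b x else 0)"
    and push_b: "e \<in> edges G \<Longrightarrow> x \<in> X \<Longrightarrow>
      push e (b x) = (if vert x \<in> rng G e then b (lift e x) else 0)"
    and pull_b: "e \<in> edges G \<Longrightarrow> x \<in> X \<Longrightarrow>
      pull e (b x) = (if vert x \<notin> sinks G \<and> edge x = e then b (step x) else 0)"
begin

definition invariant :: "'m set \<Rightarrow> bool" where
  "invariant N \<longleftrightarrow> subspace N \<and> (\<forall>A\<in>gen_verts G. proj A ` N \<subseteq> N) \<and>
     (\<forall>e\<in>edges G. push e ` N \<subseteq> N) \<and> (\<forall>e\<in>edges G. pull e ` N \<subseteq> N)"

definition irreducible :: bool where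
  "irreducible \<longleftrightarrow> (UNIV :: 'm set) \<noteq> {0} \<and> (\<forall>N. invariant N \<longrightarrow> N = {0} \<or> N = UNIV)"

text \<open>What the three kinds of generators have in common: each maps the basis vectors with index in
  a set \<open>D\<close> injectively to basis vectors and kills all others.\<close>
definition partial_perm :: "('m \<Rightarrow> 'm) \<Rightarrow> 'x set \<Rightarrow> ('x \<Rightarrow> 'x) \<Rightarrow> bool" where
  "partial_perm L D \<sigma> \<longleftrightarrow> Vector_Spaces.linear scale scale L \<and> D \<subseteq> X \<and> \<sigma> ` D \<subseteq> X \<and> inj_on \<sigma> D \<and>
     (\<forall>x\<in>X. L (b x) = (if x \<in> D then b (\<sigma> x) else 0))"

lemma partial_perm_proj:
  "A \<in> gen_verts G \<Longrightarrow> partial_perm (proj A) {x \<in> X. vert x \<in> A} (\<lambda>x. x)"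
  unfolding partial_perm_def using linear_proj proj_b by auto

lemma partial_perm_push:
  assumes "e \<in> edges G"
  shows "partial_perm (push e) {x \<in> X. vert x \<in> rng G e} (lift e)"
proof -
  have "inj_on (lift e) {x \<in> X. vert x \<in> rng G e}"
    using step_lift[OF assms] by (intro inj_on_inverseI[of _ step]) auto
  then show ?thesis
    unfolding partial_perm_def using linear_push push_b lift_in assms by auto
qed

lemma partial_perm_pull:
  assumes "e \<in> edges G"
  shows "partial_perm (pull e) {x \<in> X. vert x \<notin> sinks G \<and> edge x = e} step"
proof -
  have "inj_on step {x \<in> X. vert x \<notin> sinks G \<and> edge x = e}"
    using lift_step by (intro inj_on_inverseI[of _ "lift e"]) auto
  then show ?thesis
    unfolding partial_perm_def using linear_pull pull_b step_in assms by auto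
qed

text \<open>A subspace that is described through itineraries only has to be checked against partial
  permutations compatible with \<open>T\<close>: they move an itinerary within its class, and both the
  domain and the new itinerary are determined by the old itinerary.\<close>
lemma invariantI:
  assumes "subspace N"
    and "\<And>L D \<sigma>. partial_perm L D \<sigma> \<Longrightarrow>
      (\<And>x. x \<in> D \<Longrightarrow> path_equiv (T x) (T (\<sigma> x))) \<Longrightarrow>
      (\<And>x y. x \<in> D \<Longrightarrow> y \<in> X \<Longrightarrow> T x = T y \<Longrightarrow> y \<in> D \<and> T (\<sigma> x) = T (\<sigma> y)) \<Longrightarrow>
      L ` N \<subseteq> N"
  shows "invariant N"
  unfolding invariant_def
proof (intro conjI ballI)
  have vert_eq: "vert x = vert y" if "x \<in> X" "y \<in> X" "T x = T y" for x y
    using that initial_vertex_T by metis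
  show "proj A ` N \<subseteq> N" if "A \<in> gen_verts G" for A
    by (rule assms(2)[OF partial_perm_proj[OF that]]) (auto simp: path_equiv_refl dest: vert_eq)
  show "push e ` N \<subseteq> N" if "e \<in> edges G" for e
  proof (rule assms(2)[OF partial_perm_push[OF that]])
    fix x assume "x \<in> {x \<in> X. vert x \<in> rng G e}"
    then have x: "x \<in> X" "vert x \<in> rng G e" by auto
    then have T_x: "T (lift e x) = cons_path e (T x)" by (rule T_lift[OF that])
    show "path_equiv (T x) (T (lift e x))"
      unfolding T_x by (rule path_equiv_sym[OF path_equiv_cons])
    fix y assume y: "y \<in> X" "T x = T y"
    then have "vert y \<in> rng G e" using vert_eq[OF x(1)] x(2) by simp
    then show "y \<in> {x \<in> X. vert x \<in> rng G e} \<and> T (lift e x) = T (lift e y)"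
      using T_lift[OF that] y T_x by simp
  qed
  show "pull e ` N \<subseteq> N" if "e \<in> edges G" for e
  proof (rule assms(2)[OF partial_perm_pull[OF that]])
    fix x assume "x \<in> {x \<in> X. vert x \<notin> sinks G \<and> edge x = e}"
    then have x: "x \<in> X" "vert x \<notin> sinks G" "edge x = e" by auto
    show "path_equiv (T x) (T (step x))"
      using x by (simp add: T_cons path_equiv_cons)
    fix y assume "y \<in> X" "T x = T y"
    then show "y \<in> {x \<in> X. vert x \<notin> sinks G \<and> edge x = e} \<and> T (step x) = T (step y)"
      using T_eq_cons[of y e "T (step x)"] T_cons[of x] x by simp
  qed
qed fact

lemma invariant_subspace: "invariant N \<Longrightarrow> subspace N"
  and invariant_push: "invariant N \<Longrightarrow> e \<in> edges G \<Longrightarrow> m \<in> N \<Longrightarrow> push e m \<in> N"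
  and invariant_pull: "invariant N \<Longrightarrow> e \<in> edges G \<Longrightarrow> m \<in> N \<Longrightarrow> pull e m \<in> N"
  unfolding invariant_def by blast+

lemma basis_expansion:
  obtains F c where "finite F" "F \<subseteq> X" "\<And>x. x \<in> F \<Longrightarrow> c x \<noteq> 0" "m = (\<Sum>x\<in>F. c x *s b x)"
proof -
  have "m \<in> span (b ` X)" using span_b by simp
  then obtain t r where t: "finite t" "t \<subseteq> b ` X" and m: "m = (\<Sum>a\<in>t. r a *s a)"
    unfolding span_explicit by blast
  define F where "F = {x \<in> X. b x \<in> t \<and> r (b x) \<noteq> 0}"
  have inj: "inj_on b F" using inj_b by (rule inj_on_subset) (auto simp: F_def)
  have img: "b ` F = {a \<in> t. r a \<noteq> 0}" using t by (auto simp: F_def)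
  have "finite F" by (rule finite_imageD[OF _ inj]) (simp add: img t)
  moreover have "m = (\<Sum>a\<in>{a \<in> t. r a \<noteq> 0}. r a *s a)"
    unfolding m by (rule sum.mono_neutral_right) (use t in auto)
  then have "m = (\<Sum>x\<in>F. r (b x) *s b x)"
    unfolding img[symmetric] by (simp add: sum.reindex[OF inj])
  ultimately show ?thesis by (intro that[of F "\<lambda>x. r (b x)"]) (auto simp: F_def)
qed

text \<open>The sets of indices that occur with nonzero coefficients in some vector of \<open>N\<close>. A minimal
  one is sought in order to find a basis vector in \<open>N\<close>.\<close>
definition support_of :: "'m set \<Rightarrow> 'x set \<Rightarrow> bool" where
  "support_of N F \<longleftrightarrow> finite F \<and> F \<subseteq> X \<and> F \<noteq> {} \<and>
     (\<exists>c. (\<forall>x\<in>F. c x \<noteq> 0) \<and> (\<Sum>x\<in>F. c x *s b x) \<in> N)"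

text \<open>Injectivity of \<open>\<sigma>\<close> matters here: no two terms are merged, so no coefficient can cancel.\<close>
lemma support_of_image:
  assumes "support_of N F" "partial_perm L D \<sigma>" "L ` N \<subseteq> N" "F \<inter> D \<noteq> {}"
  shows "support_of N (\<sigma> ` (F \<inter> D))"
proof -
  obtain c where F: "finite F" "F \<subseteq> X" "\<And>x. x \<in> F \<Longrightarrow> c x \<noteq> 0"
    and N: "(\<Sum>x\<in>F. c x *s b x) \<in> N"
    using assms(1) by (auto simp: support_of_def)
  have lin: "Vector_Spaces.linear scale scale L" and inj: "inj_on \<sigma> (F \<inter> D)"
    and L: "\<And>x. x \<in> X \<Longrightarrow> L (b x) = (if x \<in> D then b (\<sigma> x) else 0)"
    using assms(2) by (auto simp: partial_perm_def intro: inj_on_subset)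
  interpret L: Vector_Spaces.linear scale scale L by (rule lin)
  define c' where "c' = c \<circ> the_inv_into (F \<inter> D) \<sigma>"
  have c': "c' (\<sigma> x) = c x" if "x \<in> F \<inter> D" for x
    using the_inv_into_f_f[OF inj that] by (simp add: c'_def)
  have "L (\<Sum>x\<in>F. c x *s b x) = (\<Sum>x\<in>F. c x *s L (b x))"
    by (simp add: L.sum L.scale)
  also have "\<dots> = (\<Sum>x\<in>F. if x \<in> D then c x *s b (\<sigma> x) else 0)"
    using F L by (intro sum.cong) auto
  also have "\<dots> = (\<Sum>x\<in>F \<inter> D. c x *s b (\<sigma> x))"
    using F by (simp add: sum.inter_restrict)
  also have "\<dots> = (\<Sum>y\<in>\<sigma> ` (F \<inter> D). c' y *s b y)"
    using c' by (simp add: sum.reindex[OF inj])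
  finally have "(\<Sum>y\<in>\<sigma> ` (F \<inter> D). c' y *s b y) \<in> N"
    using N assms(3) by (metis image_subset_iff)
  moreover have "\<forall>y\<in>\<sigma> ` (F \<inter> D). c' y \<noteq> 0" using F c' by auto
  moreover have "\<sigma> ` (F \<inter> D) \<subseteq> X" using assms(2) by (auto simp: partial_perm_def)
  ultimately show ?thesis using F assms(4) unfolding support_of_def by blast
qed

text \<open>Following the common steps of the two points with \<open>s\<^sub>e\<^sup>*\<close> moves both of them along and
  keeps them in the support, which does not grow. Where they part, \<open>p\<^sub>v\<close> or \<open>s\<^sub>e\<^sup>*\<close> removes at
  least the second one and keeps the first, so that what remains is nonempty.\<close>
lemma support_of_shrink:
  assumes "separable x x'" "invariant N" "support_of N F" "x \<in> F" "x' \<in> F"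
  shows "\<exists>F'. support_of N F' \<and> card F' < card F"
  using assms(1,3-5)
proof (induction arbitrary: F)
  case (vert x x')
  then have F: "finite F" "x \<in> X" by (auto simp: support_of_def)
  have A: "{vert x} \<in> gen_verts G" using F vert_in by (auto intro: gen_verts.vertex)
  let ?D = "{y \<in> X. vert y \<in> {vert x}}"
  have "support_of N ((\<lambda>y. y) ` (F \<inter> ?D))"
    using assms(2) A F vert by (intro support_of_image[OF _ partial_perm_proj]) (auto simp: invariant_def)
  moreover have "x' \<notin> F \<inter> ?D" using vert by auto
  then have "F \<inter> ?D \<subset> F" using vert by blast
  then have "card (F \<inter> ?D) < card F" using F by (simp add: psubset_card_mono)
  ultimately show ?case by (metis image_ident)
next
  case (edge x x')
  then have F: "finite F" "x \<in> X" by (auto simp: support_of_def)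
  have e: "edge x \<in> edges G" using F edge edge_in by auto
  let ?D = "{y \<in> X. vert y \<notin> sinks G \<and> edge y = edge x}"
  have "support_of N (step ` (F \<inter> ?D))"
    using assms(2) e F edge by (intro support_of_image[OF _ partial_perm_pull]) (auto simp: invariant_def)
  moreover have "x' \<notin> F \<inter> ?D" using edge by auto
  then have "F \<inter> ?D \<subset> F" using edge by blast
  then have "card (F \<inter> ?D) < card F" using F by (simp add: psubset_card_mono)
  then have "card (step ` (F \<inter> ?D)) < card F"
    using card_image_le[of "F \<inter> ?D" step] F by simp
  ultimately show ?case by blast
next
  case (step x x')
  then have F: "finite F" "x \<in> X" "x' \<in> X" by (auto simp: support_of_def)
  have e: "edge x \<in> edges G" using F step edge_in by auto
  let ?D = "{y \<in> X. vert y \<notin> sinks G \<and> edge y = edge x}"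
  have "support_of N (step ` (F \<inter> ?D))"
    using assms(2) e F step by (intro support_of_image[OF _ partial_perm_pull]) (auto simp: invariant_def)
  moreover have "step x \<in> step ` (F \<inter> ?D)" "step x' \<in> step ` (F \<inter> ?D)"
    using step F by auto
  ultimately obtain F' where "support_of N F'" "card F' < card (step ` (F \<inter> ?D))"
    using step.IH by blast
  moreover have "card (step ` (F \<inter> ?D)) \<le> card F"
    using F card_image_le[of "F \<inter> ?D" step] card_mono[of F "F \<inter> ?D"] by fastforce
  ultimately show ?case by (meson less_le_trans)
qed

text \<open>When \<open>T\<close> is injective, distinct points are separable, and a support of least
  cardinality must be a singleton.\<close>
lemma invariant_contains_basis_vector:
  assumes "inj_on T X" "invariant N" "m \<in> N" "m \<noteq> 0"
  obtains x where "x \<in> X" "b x \<in> N"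
proof -
  have "\<exists>F. support_of N F"
  proof -
    obtain F c where "finite F" "F \<subseteq> X" "\<And>x. x \<in> F \<Longrightarrow> c x \<noteq> 0" "m = (\<Sum>x\<in>F. c x *s b x)"
      using basis_expansion[of m] by metis
    then show ?thesis using assms(3,4) unfolding support_of_def by (intro exI[of _ F]) auto
  qed
  then obtain F where F: "support_of N F" and least: "\<And>F'. support_of N F' \<Longrightarrow> card F \<le> card F'"
    using ex_has_least_nat[of "support_of N" _ card] by metis
  obtain x where x: "x \<in> F" "x \<in> X" using F by (auto simp: support_of_def)
  have "F = {x}"
  proof (rule ccontr)
    assume "F \<noteq> {x}"
    then obtain x' where x': "x' \<in> F" "x' \<noteq> x" using x by auto
    then have "x' \<in> X" using F by (auto simp: support_of_def)
    then have "separable x x'"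
      using not_separable_imp_T_eq assms(1) x x' by (metis inj_onD)
    then show False using support_of_shrink[OF _ assms(2) F x(1) x'(1)] least
      by (metis not_le)
  qed
  then obtain c where c: "c \<noteq> 0" "c *s b x \<in> N" using F by (auto simp: support_of_def)
  then have "inverse c *s c *s b x \<in> N" using invariant_subspace[OF assms(2)] by (rule_tac subspace_scale)
  then show ?thesis using that x c by simp
qed

lemma invariant_step:
  assumes "invariant N" "x \<in> X" "b x \<in> N" "vert x \<notin> sinks G"
  shows "b (step x) \<in> N"
proof -
  have "pull (edge x) (b x) \<in> N" using assms edge_in invariant_pull by blast
  then show ?thesis using assms edge_in by (simp add: pull_b)
qed

lemma invariant_lift:
  assumes "invariant N" "x \<in> X" "b (step x) \<in> N" "vert x \<notin> sinks G"
  shows "b x \<in> N"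
proof -
  have "push (edge x) (b (step x)) \<in> N" using assms edge_in invariant_push by blast
  then show ?thesis using assms edge_in step_in vert_step lift_step by (simp add: push_b)
qed

lemma invariant_suffix:
  assumes "invariant N" "x \<in> X" "b x \<in> N" "T x = prepend \<alpha> r"
  shows "\<exists>y\<in>X. T y = r \<and> b y \<in> N"
  using assms
proof (induction \<alpha> arbitrary: x)
  case (Cons e \<alpha>)
  then have "T x = cons_path e (prepend \<alpha> r)" by simp
  note * = T_eq_cons[OF Cons.prems(2) this]
  show ?case using Cons * invariant_step step_in by metis
qed auto

lemma invariant_prefix:
  assumes "inj_on T X" "invariant N" "y \<in> X" "b y \<in> N" "x \<in> X" "T x = prepend \<alpha> (T y)"
  shows "b x \<in> N"
  using assms(5,6)
proof (induction \<alpha> arbitrary: x)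
  case Nil
  then show ?case using assms by (auto dest: inj_onD)
next
  case (Cons e \<alpha>)
  then have "T x = cons_path e (prepend \<alpha> (T y))" by simp
  note * = T_eq_cons[OF Cons.prems(1) this]
  show ?case using Cons * invariant_lift[OF assms(2)] step_in by metis
qed

text \<open>The operators \<open>s\<^sub>e\<^sup>*\<close> lead from \<open>b x\<close> down to the basis vector of a common tail
  of the two itineraries, and the operators \<open>s\<^sub>e\<close> lead up again to \<open>b y\<close>. Injectivity
  of \<open>T\<close> guarantees that the tails of \<open>x\<close> and of \<open>y\<close> belong to the same point.\<close>
lemma invariant_path_equiv:
  assumes "inj_on T X" "invariant N" "x \<in> X" "b x \<in> N" "y \<in> X" "path_equiv (T x) (T y)"
  shows "b y \<in> N"
proof -
  obtain \<alpha> \<beta> r where r: "T x = prepend \<alpha> r" "T y = prepend \<beta> r"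
    using assms(6) by (auto simp: path_equiv_iff_common_tail)
  obtain z where "z \<in> X" "T z = r" "b z \<in> N" using invariant_suffix[OF assms(2-4) r(1)] by blast
  then show ?thesis using invariant_prefix[OF assms(1,2)] r assms(5) by metis
qed

lemma b_in_span_iff:
  assumes "x \<in> X" "S \<subseteq> X" shows "b x \<in> span (b ` S) \<longleftrightarrow> x \<in> S"
proof
  assume *: "b x \<in> span (b ` S)"
  show "x \<in> S"
  proof (rule ccontr)
    assume "x \<notin> S"
    then have "b ` S \<subseteq> b ` X - {b x}" using assms inj_b by (auto dest: inj_onD)
    then have "b x \<in> span (b ` X - {b x})" using * span_mono by blast
    then show False using indep_b assms(1) by (auto simp: dependent_def)
  qed
qed (auto intro: span_base)

text \<open>No generator leaves an equivalence class, since it adds or removes at most one edge at the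
  beginning of an itinerary.\<close>
lemma invariant_span_class: "invariant (span (b ` {x \<in> X. path_equiv p (T x)}))"
proof (rule invariantI)
  let ?S = "{x \<in> X. path_equiv p (T x)}"
  fix L D \<sigma> assume L: "partial_perm L D \<sigma>" and T: "\<And>x. x \<in> D \<Longrightarrow> path_equiv (T x) (T (\<sigma> x))"
  interpret L: Vector_Spaces.linear scale scale L using L by (simp add: partial_perm_def)
  have "L (b x) \<in> span (b ` ?S)" if "x \<in> ?S" for x
  proof (cases "x \<in> D")
    case True
    then have "\<sigma> x \<in> ?S" using that T[OF True] L path_equiv_trans by (auto simp: partial_perm_def)
    then show ?thesis using L that True by (auto simp: partial_perm_def intro!: span_base)
  qed (use L that in \<open>auto simp: partial_perm_def intro: span_zero\<close>)
  then have "L ` b ` ?S \<subseteq> span (b ` ?S)" by blast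
  then have "span (L ` b ` ?S) \<subseteq> span (b ` ?S)" by (intro span_minimal subspace_span)
  then show "L ` span (b ` ?S) \<subseteq> span (b ` ?S)" by (simp add: L.span_image)
qed (rule subspace_span)

lemma single_class_if_irreducible:
  assumes irreducible "x \<in> X" "y \<in> X" shows "path_equiv (T x) (T y)"
proof -
  let ?S = "{z \<in> X. path_equiv (T x) (T z)}"
  have "b x \<in> span (b ` ?S)" using assms by (auto intro!: span_base simp: path_equiv_refl)
  moreover have "b x \<noteq> 0" using indep_b assms dependent_zero by (metis imageI)
  ultimately have "span (b ` ?S) = UNIV"
    using assms(1) invariant_span_class[of "T x"] by (auto simp: irreducible_def)
  then show ?thesis using b_in_span_iff[of y ?S] assms by auto
qed

end

section \<open>The map to the path module\<close>

lemma path_basis_neq_0: "path_basis p \<noteq> (0 :: ('v, 'e) upath \<Rightarrow>\<^sub>0 'r::field)"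
  by (metis path_basis_def lookup_single_eq lookup_zero zero_neq_one)

text \<open>A path occurring in a vector of \<open>\<PP>\<^bsub>[p]\<^esub>\<close> lies in \<open>[p]\<close>; this recovers the class from
  the image of \<open>\<Phi>\<close>.\<close>
lemma keys_span_path_basis:
  assumes "f \<in> module.span pm_scale (path_basis ` C)"
  shows "Poly_Mapping.keys (f :: ('v, 'e) upath \<Rightarrow>\<^sub>0 'r::field) \<subseteq> C"
proof -
  interpret P: vector_space "pm_scale :: 'r \<Rightarrow> (('v, 'e) upath \<Rightarrow>\<^sub>0 'r) \<Rightarrow> _"
    by (rule pm_scale_vector_space)
  have "P.subspace {f. Poly_Mapping.keys f \<subseteq> C}"
  proof (rule P.subspaceI)
    fix f g :: "('v, 'e) upath \<Rightarrow>\<^sub>0 'r"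
    assume "f \<in> {f. Poly_Mapping.keys f \<subseteq> C}" "g \<in> {f. Poly_Mapping.keys f \<subseteq> C}"
    then show "f + g \<in> {f. Poly_Mapping.keys f \<subseteq> C}"
      using Poly_Mapping.keys_add[of f g] by blast
  qed (auto simp: in_keys_iff)
  moreover have "path_basis ` C \<subseteq> {f. Poly_Mapping.keys f \<subseteq> C}"
    by (auto simp: path_basis_def split: if_splits)
  ultimately show ?thesis using P.span_minimal assms by blast
qed

context branching_representation
begin

context
  fixes \<Phi> :: "'m \<Rightarrow> (('v, 'e) upath \<Rightarrow>\<^sub>0 'r)"
  assumes linear_Phi: "Vector_Spaces.linear scale pm_scale \<Phi>"
    and Phi_b: "x \<in> X \<Longrightarrow> \<Phi> (b x) = path_basis (T x)"
begin

lemma range_Phi: "range \<Phi> = module.span pm_scale (path_basis ` T ` X)"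
proof -
  interpret L: Vector_Spaces.linear scale pm_scale \<Phi> by (rule linear_Phi)
  have "range \<Phi> = module.span pm_scale (\<Phi> ` b ` X)"
    using L.span_image[of "b ` X"] span_b by simp
  also have "\<Phi> ` b ` X = path_basis ` T ` X" by (force simp: Phi_b)
  finally show ?thesis .
qed

text \<open>A vector lies in the kernel if and only if, for each path \<open>q\<close>, the coefficients of the
  indices with itinerary \<open>q\<close> add up to zero. As \<open>\<Phi> (L (b x))\<close> depends on \<open>T x\<close>
  only, being the value \<open>h (T x)\<close>, grouping the terms of \<open>\<Phi> (L m)\<close> by itinerary leaves
  multiples by these vanishing sums. This replaces an action of the algebra on \<open>\<PP>\<close> that
  \<open>\<Phi>\<close> would intertwine.\<close>
lemma invariant_kernel: "invariant {m. \<Phi> m = 0}"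
proof (rule invariantI)
  interpret Phi: Vector_Spaces.linear scale pm_scale \<Phi> by (rule linear_Phi)
  show "subspace {m. \<Phi> m = 0}" by (rule Phi.subspace_kernel)
  fix L D \<sigma> assume L: "partial_perm L D \<sigma>"
    and T: "\<And>x y. x \<in> D \<Longrightarrow> y \<in> X \<Longrightarrow> T x = T y \<Longrightarrow> y \<in> D \<and> T (\<sigma> x) = T (\<sigma> y)"
  interpret L: Vector_Spaces.linear scale scale L using L by (simp add: partial_perm_def)
  have D: "D \<subseteq> X" using L by (simp add: partial_perm_def)
  define h where "h q = \<Phi> (L (b (SOME x. x \<in> X \<and> T x = q)))" for q
  have h: "\<Phi> (L (b x)) = h (T x)" if "x \<in> X" for x
  proof -
    define y where "y = (SOME y. y \<in> X \<and> T y = T x)"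
    have y: "y \<in> X" "T y = T x" using someI[of "\<lambda>y. y \<in> X \<and> T y = T x" x] that by (auto simp: y_def)
    have "y \<in> D \<longleftrightarrow> x \<in> D" using T[of x y] T[of y x] y that by auto
    moreover have "T (\<sigma> x) = T (\<sigma> y)" if "x \<in> D" using T[OF that y(1)] y by simp
    moreover have "\<sigma> x \<in> X" if "x \<in> D" for x using L that by (auto simp: partial_perm_def)
    ultimately show ?thesis
      using L that y by (auto simp: h_def partial_perm_def Phi_b simp flip: y_def)
  qed
  show "L ` {m. \<Phi> m = 0} \<subseteq> {m. \<Phi> m = 0}"
  proof clarify
    fix m assume m: "\<Phi> m = 0"
    obtain F c where F: "finite F" "F \<subseteq> X" and m_eq: "m = (\<Sum>x\<in>F. c x *s b x)"
      using basis_expansion[of m] by metis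
    have coeff: "(\<Sum>x\<in>{x \<in> F. T x = q}. c x) = 0" for q
    proof -
      have "0 = Poly_Mapping.lookup (\<Phi> m) q" by (simp add: m)
      also have "\<dots> = (\<Sum>x\<in>F. c x * Poly_Mapping.lookup (\<Phi> (b x)) q)"
        by (simp add: m_eq Phi.sum Phi.scale lookup_sum)
      also have "\<dots> = (\<Sum>x\<in>F. if T x = q then c x else 0)"
        using F by (intro sum.cong) (auto simp: Phi_b path_basis_def lookup_single when_def)
      also have "\<dots> = (\<Sum>x\<in>{x \<in> F. T x = q}. c x)"
        using F by (simp add: sum.inter_filter)
      finally show ?thesis by simp
    qed
    have "\<Phi> (L m) = (\<Sum>x\<in>F. pm_scale (c x) (\<Phi> (L (b x))))"
      by (simp add: m_eq Phi.sum Phi.scale L.sum L.scale)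
    also have "\<dots> = (\<Sum>x\<in>F. pm_scale (c x) (h (T x)))"
      using F h by (intro sum.cong) auto
    also have "\<dots> = (\<Sum>q\<in>T ` F. \<Sum>x\<in>{x \<in> F. T x = q}. pm_scale (c x) (h (T x)))"
      by (rule sum.image_gen) (rule F)
    also have "\<dots> = (\<Sum>q\<in>T ` F. pm_scale (\<Sum>x\<in>{x \<in> F. T x = q}. c x) (h q))"
      by (simp add: module.scale_sum_left[OF pm_scale_module])
    also have "\<dots> = 0" by (simp add: coeff)
    finally show "\<Phi> (L m) = 0" .
  qed
qed

text \<open>All itineraries are equivalent and fill the class, so \<open>\<Phi>\<close> maps onto the path module; its
  kernel is invariant and omits every basis vector, so it vanishes.\<close>
lemma irreducible_imp_Phi_iso:
  assumes irreducible
  shows "\<exists>p\<in>upaths G. bij_betw \<Phi> UNIV (path_module G p)"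
proof -
  interpret Phi: Vector_Spaces.linear scale pm_scale \<Phi> by (rule linear_Phi)
  have "X \<noteq> {}" using assms span_b by (auto simp: irreducible_def)
  then obtain x where x: "x \<in> X" by blast
  have "T ` X = path_class G (T x)"
    using path_class_realised[OF x] single_class_if_irreducible[OF assms x] T_in_upaths
    by (auto simp: path_class_def)
  then have "range \<Phi> = path_module G (T x)" by (simp add: range_Phi path_module_def)
  moreover have "inj \<Phi>"
  proof -
    have "\<Phi> (b x) \<noteq> 0" using Phi_b[OF x] by (simp add: path_basis_neq_0)
    then have "{m. \<Phi> m = 0} = {0}" using assms invariant_kernel by (auto simp: irreducible_def)
    then show ?thesis using Phi.inj_iff_eq_0 by auto
  qed
  ultimately show ?thesis using T_in_upaths[OF x] by (auto simp: bij_betw_def)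
qed

text \<open>An isomorphism makes \<open>T\<close> injective with values in one class. Then a nonzero invariant
  subspace contains one basis vector and, by equivalence of itineraries, all of them.\<close>
lemma Phi_iso_imp_irreducible:
  assumes "p \<in> upaths G" "bij_betw \<Phi> UNIV (path_module G p)"
  shows irreducible
  unfolding irreducible_def
proof (intro conjI allI impI)
  interpret Phi: Vector_Spaces.linear scale pm_scale \<Phi> by (rule linear_Phi)
  have inj: "inj \<Phi>" and range_eq: "range \<Phi> = path_module G p"
    using assms(2) by (auto simp: bij_betw_def)
  have inj_T: "inj_on T X"
    using inj_b Phi_b injD[OF inj] by (intro inj_onI) (metis inj_onD)
  have T_class: "T x \<in> path_class G p" if "x \<in> X" for x
  proof -
    have "(path_basis (T x) :: ('v, 'e) upath \<Rightarrow>\<^sub>0 'r) \<in> path_module G p"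
      unfolding range_eq[symmetric] using Phi_b[OF that] by (metis rangeI)
    then show ?thesis unfolding path_module_def
      by (drule_tac keys_span_path_basis) (simp add: path_basis_def)
  qed
  show "(UNIV :: 'm set) \<noteq> {0}"
  proof
    assume "(UNIV :: 'm set) = {0}"
    then have "range \<Phi> = {0}" by (metis Phi.zero image_empty image_insert)
    moreover have "(path_basis p :: ('v, 'e) upath \<Rightarrow>\<^sub>0 'r) \<in> path_module G p"
      using assms(1) by (auto simp: path_module_def path_class_def path_equiv_refl intro!: module.span_base[OF pm_scale_module])
    ultimately show False using range_eq path_basis_neq_0 by auto
  qed
  fix N assume N: "invariant N"
  show "N = {0} \<or> N = UNIV"
  proof (cases "N \<subseteq> {0}")
    case True
    then show ?thesis using N subspace_0 by (auto simp: invariant_def)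
  next
    case False
    then obtain m where "m \<in> N" "m \<noteq> 0" by auto
    then obtain x where x: "x \<in> X" "b x \<in> N"
      using invariant_contains_basis_vector[OF inj_T N] by blast
    have "b y \<in> N" if "y \<in> X" for y
    proof (rule invariant_path_equiv[OF inj_T N x that])
      show "path_equiv (T x) (T y)"
        using T_class[OF x(1)] T_class[OF that]
        by (auto simp: path_class_def intro: path_equiv_trans path_equiv_sym)
    qed
    then have "span (b ` X) \<subseteq> N" using N by (intro span_minimal) (auto simp: invariant_def)
    then show ?thesis using span_b by auto
  qed
qed

theorem irreducible_iff_Phi_iso:
  "irreducible \<longleftrightarrow> (\<exists>p\<in>upaths G. bij_betw \<Phi> UNIV (path_module G p))"
  using irreducible_imp_Phi_iso Phi_iso_imp_irreducible by blast

end

end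


section \<open>Representations of the Leavitt path algebra through the generators\<close>

lemma gen_in_free_alg: "g \<in> S \<Longrightarrow> gen g \<in> free_alg S"
  by (auto simp: gen_def free_alg_def)

lemma zero_in_free_alg: "0 \<in> free_alg S"
  by (simp add: free_alg_def)

lemma single_word_Cons:
  "Poly_Mapping.single (Word (g # ls)) (1::'r::comm_ring_1) =
    (if ls = [] then gen g else gen g * Poly_Mapping.single (Word ls) 1)"
  by (auto simp: gen_def mult_single plus_fword_def)

text \<open>The free algebra is spanned by nonempty words, which are built by multiplying with one
  generator at a time. Closure under generators therefore suffices for invariant subspaces.\<close>
lemma free_alg_induct [consumes 1, case_names zero gen add scale mult]:
  fixes f :: "'g fword \<Rightarrow>\<^sub>0 'r::comm_ring_1"
  assumes f: "f \<in> free_alg S"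
    and zero: "P 0"
    and gen: "\<And>g. g \<in> S \<Longrightarrow> P (gen g)"
    and add: "\<And>f h. f \<in> free_alg S \<Longrightarrow> h \<in> free_alg S \<Longrightarrow> P f \<Longrightarrow> P h \<Longrightarrow> P (f + h)"
    and scale: "\<And>c f. f \<in> free_alg S \<Longrightarrow> P f \<Longrightarrow> P (pm_scale c f)"
    and mult: "\<And>g f. g \<in> S \<Longrightarrow> f \<in> free_alg S \<Longrightarrow> P f \<Longrightarrow> P (gen g * f)"
  shows "P f"
proof -
  have word: "(Poly_Mapping.single (Word ls) 1 :: 'g fword \<Rightarrow>\<^sub>0 'r) \<in> free_alg S \<and>
      P (Poly_Mapping.single (Word ls) 1)"
    if "ls \<noteq> []" "set ls \<subseteq> S" for ls
    using that
  proof (induction ls)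
    case (Cons g ls)
    then show ?case
      using gen[of g] mult[of g "Poly_Mapping.single (Word ls) 1"]
      by (auto simp: single_word_Cons gen_in_free_alg free_alg_mult)
  qed simp
  have sum: "(\<Sum>w\<in>W. pm_scale (Poly_Mapping.lookup f w) (Poly_Mapping.single w 1)) \<in> free_alg S \<and>
      P (\<Sum>w\<in>W. pm_scale (Poly_Mapping.lookup f w) (Poly_Mapping.single w 1))"
    if "finite W" "W \<subseteq> Poly_Mapping.keys f" for W
    using that
  proof (induction W)
    case (insert w W)
    moreover have "(Poly_Mapping.single w 1 :: 'g fword \<Rightarrow>\<^sub>0 'r) \<in> free_alg S \<and> P (Poly_Mapping.single w 1)"
      using word[of "letters w"] f insert.prems by (auto simp: free_alg_def)
    ultimately show ?case by (simp add: add scale free_alg_add free_alg_scale)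
  qed (simp add: zero zero_in_free_alg)
  have "f = (\<Sum>w\<in>Poly_Mapping.keys f. pm_scale (Poly_Mapping.lookup f w) (Poly_Mapping.single w 1))"
    by (rule poly_mapping_eqI)
      (auto simp: lookup_sum lookup_single when_def in_keys_iff if_distrib cong: if_cong)
  then show ?thesis using sum[of "Poly_Mapping.keys f"] by simp
qed

text \<open>Elements of the algebra are evaluated on representatives in the free algebra, where the
  defining relations can be applied term by term.\<close>
locale lpa_rep =
  fixes G :: "('v, 'e) pre_ultragraph"
    and scale :: "'r::field \<Rightarrow> 'm::ab_group_add \<Rightarrow> 'm"
    and \<psi> :: "('v, 'e, 'r) lpa_elem \<Rightarrow> 'm \<Rightarrow> 'm"
  assumes vector_space: "vector_space scale"
    and representation: "lpa_representation G scale \<psi>"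
begin

sublocale vector_space scale by (rule vector_space)

definition eval_gen :: "(('v, 'e) lpa_gen fword \<Rightarrow>\<^sub>0 'r) \<Rightarrow> 'm \<Rightarrow> 'm" where
  "eval_gen f = \<psi> (pres_class (lpa_gens G) (lpa_rels G) f)"

definition P_op :: "'v set \<Rightarrow> 'm \<Rightarrow> 'm" where "P_op A = eval_gen (gen (Proj A))"
definition S_op :: "'e \<Rightarrow> 'm \<Rightarrow> 'm" where "S_op e = eval_gen (gen (Edge e))"
definition S_star_op :: "'e \<Rightarrow> 'm \<Rightarrow> 'm" where "S_star_op e = eval_gen (gen (Ghost e))"

lemma linear_eval: "f \<in> free_alg (lpa_gens G) \<Longrightarrow> Vector_Spaces.linear scale scale (eval_gen f)"
  using representation by (simp add: lpa_representation_def eval_gen_def pres_class_in)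

lemma eval_add:
  "f \<in> free_alg (lpa_gens G) \<Longrightarrow> h \<in> free_alg (lpa_gens G) \<Longrightarrow>
    eval_gen (f + h) = (\<lambda>m. eval_gen f m + eval_gen h m)"
  using representation
  by (simp add: lpa_representation_def eval_gen_def pres_class_in flip: pres_add_class)

lemma eval_scale:
  "f \<in> free_alg (lpa_gens G) \<Longrightarrow> eval_gen (pm_scale c f) = (\<lambda>m. scale c (eval_gen f m))"
  using representation
  by (simp add: lpa_representation_def eval_gen_def pres_class_in flip: pres_scale_class)

lemma eval_mult:
  "f \<in> free_alg (lpa_gens G) \<Longrightarrow> h \<in> free_alg (lpa_gens G) \<Longrightarrow>
    eval_gen (f * h) = eval_gen f \<circ> eval_gen h"
  using representation
  by (simp add: lpa_representation_def eval_gen_def pres_class_in flip: pres_mult_class)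

lemma eval_zero: "eval_gen 0 = (\<lambda>m. 0)"
proof -
  have "pm_scale 0 0 = (0 :: ('v, 'e) lpa_gen fword \<Rightarrow>\<^sub>0 'r)" by (rule poly_mapping_eqI) simp
  then show ?thesis using eval_scale[of 0 0] by (simp add: zero_in_free_alg)
qed

lemma eval_rel:
  "f \<in> free_alg (lpa_gens G) \<Longrightarrow> h \<in> free_alg (lpa_gens G) \<Longrightarrow> f - h \<in> lpa_rels G \<Longrightarrow>
    eval_gen f = eval_gen h"
  unfolding eval_gen_def by (subst pres_class_eq_iff[THEN iffD2]) (auto intro: rel_ideal.rel)

lemma gens_in_free_alg:
  "A \<in> gen_verts G \<Longrightarrow> gen (Proj A) \<in> free_alg (lpa_gens G)"
  "e \<in> edges G \<Longrightarrow> gen (Edge e) \<in> free_alg (lpa_gens G)"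
  "e \<in> edges G \<Longrightarrow> gen (Ghost e) \<in> free_alg (lpa_gens G)"
  by (auto intro!: gen_in_free_alg simp: lpa_gens_def)

lemma P_empty: "P_op {} m = 0"
  using eval_rel[OF gens_in_free_alg(1) zero_in_free_alg, of "{}"]
  by (simp add: P_op_def eval_zero gen_verts.empty lpa_rels.proj_empty)

lemma P_P: "A \<in> gen_verts G \<Longrightarrow> B \<in> gen_verts G \<Longrightarrow> P_op A (P_op B m) = P_op (A \<inter> B) m"
  using eval_rel[OF _ _ lpa_rels.proj_inter[of A G B]]
  by (simp add: P_op_def gens_in_free_alg free_alg_mult gen_verts.inter eval_mult fun_eq_iff)

lemma S_P: "e \<in> edges G \<Longrightarrow> S_op e (P_op (rng G e) m) = S_op e m"
  using eval_rel[OF _ _ lpa_rels.edge_rng[of e G]]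
  by (simp add: P_op_def S_op_def gens_in_free_alg free_alg_mult gen_verts.range eval_mult fun_eq_iff)

lemma S_star_P:
  "e \<in> edges G \<Longrightarrow> src G e \<in> verts G \<Longrightarrow> S_star_op e (P_op {src G e} m) = S_star_op e m"
  using eval_rel[OF _ _ lpa_rels.ghost_src[of e G]]
  by (simp add: P_op_def S_star_op_def gens_in_free_alg free_alg_mult gen_verts.vertex eval_mult fun_eq_iff)

lemma S_star_S:
  "e \<in> edges G \<Longrightarrow> f \<in> edges G \<Longrightarrow>
    S_star_op e (S_op f m) = (if e = f then P_op (rng G e) m else 0)"
  using eval_rel[OF _ _ lpa_rels.ghost_edge[of e G f]]
  by (auto simp: P_op_def S_op_def S_star_op_def gens_in_free_alg zero_in_free_alg free_alg_mult
      gen_verts.range eval_mult eval_zero fun_eq_iff split: if_splits)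

lemma M_set_eq: "M_set G \<psi> A = range (P_op A)"
  by (simp add: M_set_def lpa_p_def P_op_def eval_gen_def)

lemma psi_lpa_s: "\<psi> (lpa_s G e) = S_op e"
  by (simp add: lpa_s_def S_op_def eval_gen_def)

lemma invariant_iff_generators:
  assumes "subspace N"
  shows "(\<forall>x\<in>lpa G. \<psi> x ` N \<subseteq> N) \<longleftrightarrow>
    (\<forall>A\<in>gen_verts G. P_op A ` N \<subseteq> N) \<and> (\<forall>e\<in>edges G. S_op e ` N \<subseteq> N) \<and>
    (\<forall>e\<in>edges G. S_star_op e ` N \<subseteq> N)" (is "?L \<longleftrightarrow> ?R")
proof
  assume ?L
  then have "eval_gen f ` N \<subseteq> N" if "f \<in> free_alg (lpa_gens G)" for f
    using pres_class_in[OF that] by (auto simp: eval_gen_def)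
  then show ?R by (simp add: P_op_def S_op_def S_star_op_def gens_in_free_alg)
next
  assume R: ?R
  have gens: "eval_gen (gen g) ` N \<subseteq> N" if "g \<in> lpa_gens G" for g
    using that R unfolding lpa_gens_def P_op_def S_op_def S_star_op_def by blast
  have "eval_gen f ` N \<subseteq> N" if "f \<in> free_alg (lpa_gens G)" for f
    using that
  proof (induction f rule: free_alg_induct)
    case zero
    then show ?case using subspace_0[OF assms] by (auto simp: eval_zero)
  next
    case (gen g)
    then show ?case by (rule gens)
  next
    case (add f h)
    then show ?case using subspace_add[OF assms] by (auto simp: eval_add)
  next
    case (scale c f)
    then show ?case using subspace_scale[OF assms] by (auto simp: eval_scale)
  next
    case (mult g f)
    then show ?case using gens[of g] by (auto simp: eval_mult gen_in_free_alg)
  qed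
  then show ?L by (auto simp: pres_alg_def quotient_def eval_gen_def pres_class_def)
qed

end


section \<open>Bases of direct sums\<close>

lemma internal_direct_sum_zeroD:
  assumes "internal_direct_sum scale N I F" "finite J" "J \<subseteq> I" "\<And>j. j \<in> J \<Longrightarrow> m j \<in> F j"
    "(\<Sum>j\<in>J. m j) = 0" "j \<in> J"
  shows "m j = 0"
  using assms unfolding internal_direct_sum_def by blast

lemma (in vector_space) internal_direct_sum_disjoint:
  assumes "internal_direct_sum scale N I F" "i \<in> I" "j \<in> I" "m \<in> F i" "m \<in> F j" "m \<noteq> 0"
  shows "i = j"
proof (rule ccontr)
  assume "i \<noteq> j"
  let ?m = "\<lambda>k. if k = i then m else - m"
  have "?m k \<in> F k" if "k \<in> {i, j}" for k
    using that assms subspace_neg by (auto simp: internal_direct_sum_def)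
  moreover have "(\<Sum>k\<in>{i, j}. ?m k) = 0" using \<open>i \<noteq> j\<close> by simp
  ultimately have "?m i = 0"
    using assms(2,3) by (intro internal_direct_sum_zeroD[OF assms(1), of "{i, j}" ?m]) auto
  then show False using assms(6) by simp
qed

text \<open>In a linear relation between vectors of the union, each vector is assigned to one summand
  \<open>\<iota> v\<close> whose basis contains it. Grouping by \<open>\<iota>\<close> splits the relation into one relation in each
  summand, by directness.\<close>
lemma (in vector_space) is_basis_direct_sum:
  assumes sum: "internal_direct_sum scale N I F" and basis: "\<And>i. i \<in> I \<Longrightarrow> is_basis scale (C i) (F i)"
  shows "is_basis scale (\<Union>i\<in>I. C i) N"
proof -
  have span_C: "span (C i) = F i" and indep: "independent (C i)" if "i \<in> I" for i
    using basis[OF that] by (auto simp: is_basis_def)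
  have "independent (\<Union>i\<in>I. C i)"
    unfolding independent_explicit_module
  proof (intro allI impI)
    fix t u v
    assume t: "finite t" "t \<subseteq> (\<Union>i\<in>I. C i)" and zero: "(\<Sum>v\<in>t. scale (u v) v) = 0" and v: "v \<in> t"
    obtain \<iota> where \<iota>: "\<And>v. v \<in> t \<Longrightarrow> \<iota> v \<in> I \<and> v \<in> C (\<iota> v)"
      using t(2) by (metis UN_E subsetD)
    let ?m = "\<lambda>i. \<Sum>v\<in>{v \<in> t. \<iota> v = i}. scale (u v) v"
    have "?m i \<in> F i" if "i \<in> \<iota> ` t" for i
    proof -
      have "?m i \<in> span (C i)" by (intro span_sum span_scale span_base) (use \<iota> in auto)
      moreover have "i \<in> I" using that \<iota> by auto
      ultimately show ?thesis by (simp add: span_C)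
    qed
    moreover have "(\<Sum>i\<in>\<iota> ` t. ?m i) = 0"
      using sum.image_gen[OF t(1), of "\<lambda>v. scale (u v) v" \<iota>] zero by simp
    ultimately have "?m (\<iota> v) = 0"
      using t(1) v \<iota> by (intro internal_direct_sum_zeroD[OF sum, of "\<iota> ` t" ?m]) auto
    moreover have "{w \<in> t. \<iota> w = \<iota> v} \<subseteq> C (\<iota> v)"
      using \<iota> by (metis (mono_tags, lifting) mem_Collect_eq subsetI)
    ultimately show "u v = 0"
      using \<iota>[OF v] t(1) v
      by (intro independentD[OF indep[of "\<iota> v"], of "{w \<in> t. \<iota> w = \<iota> v}"]) auto
  qed
  moreover have "span (\<Union>i\<in>I. C i) = N"
  proof -
    have "N = span (\<Union>i\<in>I. F i)" using sum by (simp add: internal_direct_sum_def)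
    also have "\<dots> = span (\<Union>i\<in>I. C i)"
    proof (intro subset_antisym span_minimal subspace_span UN_least)
      fix i assume "i \<in> I"
      then show "F i \<subseteq> span (\<Union>i\<in>I. C i)" using span_mono[of "C i"] span_C by blast
      show "C i \<subseteq> span (\<Union>i\<in>I. F i)" using span_superset[of "C i"] span_C[OF \<open>i \<in> I\<close>] \<open>i \<in> I\<close>
        by (auto intro: span_base)
    qed
    finally show ?thesis by simp
  qed
  ultimately show ?thesis by (simp add: is_basis_def)
qed


section \<open>The branching system of a perfect permutative representation\<close>

text \<open>Perfection makes the chosen bases into a basis of the whole space, and directness of the sums
  gives each index one vertex and one edge, so that the definite descriptions in the definition of
  \<open>T\<close> denote what they should. The relations of the algebra then fix the action of
  each generator on the basis.\<close>
locale permutative_rep = lpa_rep G scale \<psi>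
  for G :: "('v, 'e) pre_ultragraph"
    and scale :: "'r::field \<Rightarrow> 'm::ab_group_add \<Rightarrow> 'm"
    and \<psi> :: "('v, 'e, 'r) lpa_elem \<Rightarrow> 'm \<Rightarrow> 'm" +
  fixes Be :: "'e \<Rightarrow> 'm set" and Bs :: "'v \<Rightarrow> 'm set" and X :: "'x set" and b :: "'x \<Rightarrow> 'm"
  assumes ultragraph: "ultragraph G"
    and perfect: "perfect_representation G scale \<psi>"
    and permutative: "permutative_bases G scale \<psi> Be Bs"
    and bij_b: "bij_betw b X (B_set G Be Bs (verts G))"
begin

abbreviation "vert \<equiv> vert_of G Be Bs X b"
abbreviation "edge \<equiv> edge_of G Be Bs X b"
abbreviation "next_idx \<equiv> step G \<psi> Be Bs X b"
abbreviation "lift_idx \<equiv> g_map G \<psi> Be X b"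
abbreviation "path \<equiv> T_map G \<psi> Be Bs X b"

lemma src_in: "e \<in> edges G \<Longrightarrow> src G e \<in> verts G"
  and rng_in: "e \<in> edges G \<Longrightarrow> rng G e \<subseteq> verts G"
  using ultragraph by (auto simp: ultragraph_def)

lemma src_not_sink: "e \<in> edges G \<Longrightarrow> src G e \<notin> sinks G"
  by (auto simp: sinks_def out_edges_def)

lemma inj_b: "inj_on b X" and image_b: "b ` X = (\<Union>v\<in>verts G. B_vert G Be Bs v)"
  using bij_b by (auto simp: bij_betw_def B_set_def)

lemma sum_edges:
  "v \<in> verts G \<Longrightarrow> v \<notin> sinks G \<Longrightarrow>
    internal_direct_sum scale (M_set G \<psi> {v}) (out_edges G v) (M_edge G \<psi>)"
  and sum_verts: "internal_direct_sum scale UNIV (verts G) (\<lambda>v. M_set G \<psi> {v})"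
  using perfect by (auto simp: perfect_representation_def)

lemma basis_edge: "e \<in> edges G \<Longrightarrow> is_basis scale (Be e) (M_edge G \<psi> e)"
  using permutative by (simp add: permutative_bases_def)

lemma basis_vert: "v \<in> verts G \<Longrightarrow> is_basis scale (B_vert G Be Bs v) (M_set G \<psi> {v})"
proof (cases "v \<in> sinks G")
  case False
  assume "v \<in> verts G"
  with False show ?thesis
    using is_basis_direct_sum[OF sum_edges, of v Be] basis_edge
    by (simp add: B_vert_def out_edges_def)
qed (use permutative in \<open>simp add: permutative_bases_def B_vert_def\<close>)

lemma basis_all: "is_basis scale (b ` X) UNIV"
  unfolding image_b by (intro is_basis_direct_sum[OF sum_verts] basis_vert)

lemma b_neq_0: "x \<in> X \<Longrightarrow> b x \<noteq> 0"
  using basis_all dependent_zero unfolding is_basis_def by (metis imageI)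

lemma basis_subset: "is_basis scale C N \<Longrightarrow> c \<in> C \<Longrightarrow> c \<in> N"
  by (auto simp: is_basis_def intro: span_base)

lemma vert_unique:
  assumes "x \<in> X" "v \<in> verts G" "w \<in> verts G" "b x \<in> B_vert G Be Bs v" "b x \<in> B_vert G Be Bs w"
  shows "v = w"
  using internal_direct_sum_disjoint[OF sum_verts assms(2,3)]
    basis_subset[OF basis_vert] assms b_neq_0 by blast

lemma D_idx_iff: "x \<in> D_idx G Be Bs X b {v} \<longleftrightarrow> x \<in> X \<and> b x \<in> B_vert G Be Bs v"
  by (auto simp: D_idx_def B_set_def)

lemma vert_eqI: "x \<in> X \<Longrightarrow> v \<in> verts G \<Longrightarrow> b x \<in> B_vert G Be Bs v \<Longrightarrow> vert x = v"
  unfolding vert_of_def D_idx_iff using vert_unique by blast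

lemma vert_in: "x \<in> X \<Longrightarrow> vert x \<in> verts G" and b_in_B_vert: "x \<in> X \<Longrightarrow> b x \<in> B_vert G Be Bs (vert x)"
proof -
  assume x: "x \<in> X"
  then obtain v where v: "v \<in> verts G" "b x \<in> B_vert G Be Bs v" using image_b by blast
  then show "vert x \<in> verts G" "b x \<in> B_vert G Be Bs (vert x)" using vert_eqI[OF x v] by auto
qed

lemma D_rng_iff:
  "e \<in> edges G \<Longrightarrow> x \<in> D_idx G Be Bs X b (rng G e) \<longleftrightarrow> x \<in> X \<and> vert x \<in> rng G e"
  using rng_in[of e] vert_eqI[of x] b_in_B_vert[of x] by (auto simp: D_idx_def B_set_def)

lemma Be_vert:
  assumes "x \<in> X" "e \<in> edges G" "b x \<in> Be e" shows "vert x = src G e"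
proof (rule vert_eqI[OF assms(1) src_in[OF assms(2)]])
  show "b x \<in> B_vert G Be Bs (src G e)"
    using assms src_not_sink[OF assms(2)] by (auto simp: B_vert_def out_edges_def)
qed

lemma Be_edge:
  assumes "x \<in> X" "e \<in> edges G" "b x \<in> Be e" shows "edge x = e"
  unfolding edge_of_def
proof (rule the_equality)
  note v = Be_vert[OF assms]
  then show "e \<in> out_edges G (vert x) \<and> x \<in> R_idx Be X b e"
    using assms by (auto simp: out_edges_def R_idx_def)
  fix f assume "f \<in> out_edges G (vert x) \<and> x \<in> R_idx Be X b f"
  then have f: "f \<in> edges G" "src G f = vert x" "b x \<in> Be f"
    by (auto simp: out_edges_def R_idx_def)
  show "f = e"
  proof (rule internal_direct_sum_disjoint[OF sum_edges])
    show "vert x \<in> verts G" "vert x \<notin> sinks G"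
      using v assms src_in src_not_sink by auto
    show "b x \<in> M_edge G \<psi> f" "b x \<in> M_edge G \<psi> e"
      using basis_subset[OF basis_edge] assms f by auto
  qed (use v assms f b_neq_0 in \<open>auto simp: out_edges_def\<close>)
qed

lemma edge_props:
  assumes "x \<in> X" "vert x \<notin> sinks G"
  shows "edge x \<in> edges G" "src G (edge x) = vert x" "b x \<in> Be (edge x)"
proof -
  obtain e where "e \<in> out_edges G (vert x)" "b x \<in> Be e"
    using b_in_B_vert[OF assms(1)] assms(2) by (auto simp: B_vert_def)
  then show "edge x \<in> edges G" "src G (edge x) = vert x" "b x \<in> Be (edge x)"
    using Be_edge[OF assms(1), of e] by (auto simp: out_edges_def)
qed

lemma linear_ops:
  "A \<in> gen_verts G \<Longrightarrow> Vector_Spaces.linear scale scale (P_op A)"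
  "e \<in> edges G \<Longrightarrow> Vector_Spaces.linear scale scale (S_op e)"
  "e \<in> edges G \<Longrightarrow> Vector_Spaces.linear scale scale (S_star_op e)"
  by (simp_all add: P_op_def S_op_def S_star_op_def linear_eval gens_in_free_alg)

lemma linear_0: "Vector_Spaces.linear scale scale f \<Longrightarrow> f 0 = 0"
  by (simp add: Vector_Spaces.linear_iff_module_hom module_hom.zero)

text \<open>A vector of \<open>M\<^sub>v\<close> is an image under \<open>p\<^sub>v\<close>, and \<open>p\<^sub>A p\<^sub>v\<close> is \<open>p\<^sub>v\<close> or \<open>p\<^sub>\<emptyset> = 0\<close>.\<close>
lemma P_b:
  assumes "A \<in> gen_verts G" "x \<in> X"
  shows "P_op A (b x) = (if vert x \<in> A then b x else 0)"
proof -
  have v: "{vert x} \<in> gen_verts G" using vert_in assms(2) by (auto intro: gen_verts.vertex)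
  have "b x \<in> M_set G \<psi> {vert x}"
    using basis_subset[OF basis_vert] vert_in b_in_B_vert assms(2) by blast
  then obtain m where m: "b x = P_op {vert x} m" by (auto simp: M_set_eq)
  then have "P_op A (b x) = P_op (A \<inter> {vert x}) m" using P_P assms(1) v by simp
  then show ?thesis using m by (simp add: P_empty)
qed

lemma lift_props:
  assumes "e \<in> edges G" "y \<in> X" "vert y \<in> rng G e"
  shows lift_in: "lift_idx e y \<in> X" and b_lift: "b (lift_idx e y) = S_op e (b y)"
    and lift_Be: "b (lift_idx e y) \<in> Be e"
proof -
  have "b y \<in> B_set G Be Bs (rng G e)"
    using assms b_in_B_vert by (auto simp: B_set_def)
  moreover have "S_op e ` B_set G Be Bs (rng G e) = Be e"
    using permutative assms(1) by (simp add: permutative_bases_def psi_lpa_s)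
  ultimately have Be: "S_op e (b y) \<in> Be e" by blast
  then have "S_op e (b y) \<in> B_vert G Be Bs (src G e)"
    using assms(1) src_not_sink by (auto simp: B_vert_def out_edges_def)
  then obtain x where x: "x \<in> X" "b x = S_op e (b y)"
    using image_b src_in[OF assms(1)] by (metis (no_types, lifting) UN_I imageE)
  have "lift_idx e y = x"
    unfolding g_map_def
  proof (rule the_equality)
    show "x \<in> R_idx Be X b e \<and> \<psi> (lpa_s G e) (b y) = b x"
      using x Be by (auto simp: R_idx_def psi_lpa_s)
    show "x' = x" if "x' \<in> R_idx Be X b e \<and> \<psi> (lpa_s G e) (b y) = b x'" for x'
      using that x inj_b by (auto simp: R_idx_def psi_lpa_s dest: inj_onD)
  qed
  then show "lift_idx e y \<in> X" "b (lift_idx e y) = S_op e (b y)" "b (lift_idx e y) \<in> Be e"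
    using x Be by auto
qed

lemma edge_lift:
  assumes "e \<in> edges G" "y \<in> X" "vert y \<in> rng G e"
  shows "edge (lift_idx e y) = e"
  using Be_edge[OF lift_in[OF assms] assms(1) lift_Be[OF assms]] .

lemma lift_not_sink:
  assumes "e \<in> edges G" "y \<in> X" "vert y \<in> rng G e"
  shows "vert (lift_idx e y) \<notin> sinks G"
  using Be_vert[OF lift_in[OF assms] assms(1) lift_Be[OF assms]] src_not_sink[OF assms(1)] by simp

text \<open>Since \<open>s\<^sub>e\<^sup>* s\<^sub>e = p\<^bsub>r(e)\<^esub>\<close> fixes \<open>b y\<close>, the operator \<open>s\<^sub>e\<^sup>*\<close> undoes
  \<open>g\<^sub>e\<close>; in particular \<open>g\<^sub>e\<close> is injective.\<close>
lemma S_star_lift: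
  assumes "e \<in> edges G" "f \<in> edges G" "y \<in> X" "vert y \<in> rng G f"
  shows "S_star_op e (b (lift_idx f y)) = (if e = f then b y else 0)"
  using assms by (simp add: b_lift S_star_S P_b gen_verts.range)

lemma next_lift:
  assumes "e \<in> edges G" "y \<in> X" "vert y \<in> rng G e"
  shows "next_idx (lift_idx e y) = y"
proof -
  have "inj_on (lift_idx e) (D_idx G Be Bs X b (rng G e))"
  proof (rule inj_onI)
    fix y z assume "y \<in> D_idx G Be Bs X b (rng G e)" "z \<in> D_idx G Be Bs X b (rng G e)"
      and eq: "lift_idx e y = lift_idx e z"
    then have yz: "y \<in> X" "vert y \<in> rng G e" "z \<in> X" "vert z \<in> rng G e"
      using D_rng_iff assms(1) by auto
    have "b y = b z"
      using S_star_lift[OF assms(1) assms(1) yz(1,2)] S_star_lift[OF assms(1) assms(1) yz(3,4)] eq by simp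
    then show "y = z" using inj_b yz by (auto dest: inj_onD)
  qed
  then have "g_inv G \<psi> Be Bs X b e (lift_idx e y) = y"
    unfolding g_inv_def using D_rng_iff assms by (intro the_inv_into_f_f) auto
  then show ?thesis
    unfolding step_def by (simp add: edge_lift[OF assms])
qed

text \<open>Surjectivity of \<open>g\<^sub>e\<close> onto the indices of \<open>B\<^sub>e\<close>, which is where the equation
  \<open>\<psi>(s\<^sub>e)(B\<^bsub>r(e)\<^esub>) = B\<^sub>e\<close> is needed in full.\<close>
lemma next_props:
  assumes "x \<in> X" "vert x \<notin> sinks G"
  shows next_in: "next_idx x \<in> X" and vert_next: "vert (next_idx x) \<in> rng G (edge x)"
    and lift_next: "lift_idx (edge x) (next_idx x) = x"
proof -
  note e = edge_props[OF assms]
  have "b x \<in> S_op (edge x) ` B_set G Be Bs (rng G (edge x))"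
    using permutative e by (simp add: permutative_bases_def psi_lpa_s)
  then obtain v c where v: "v \<in> rng G (edge x)" "c \<in> B_vert G Be Bs v" "b x = S_op (edge x) c"
    by (auto simp: B_set_def)
  then have "c \<in> b ` X" using image_b rng_in[OF e(1)] by blast
  then obtain y where y: "y \<in> X" "c = b y" by blast
  then have vy: "vert y \<in> rng G (edge x)" using vert_eqI v rng_in[OF e(1)] by blast
  then have "b (lift_idx (edge x) y) = b x" using b_lift[OF e(1) y(1)] v y by simp
  then have "lift_idx (edge x) y = x" using inj_b lift_in[OF e(1) y(1) vy] assms(1) by (auto dest: inj_onD)
  moreover have "next_idx x = y" using next_lift[OF e(1) y(1) vy] calculation by simp
  ultimately show "next_idx x \<in> X" "vert (next_idx x) \<in> rng G (edge x)"
    "lift_idx (edge x) (next_idx x) = x" using y vy by auto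
qed

lemma S_b:
  assumes "e \<in> edges G" "x \<in> X"
  shows "S_op e (b x) = (if vert x \<in> rng G e then b (lift_idx e x) else 0)"
proof (cases "vert x \<in> rng G e")
  case False
  have "S_op e (b x) = S_op e (P_op (rng G e) (b x))" using S_P assms(1) by simp
  then show ?thesis using False assms by (simp add: P_b gen_verts.range linear_0 linear_ops)
qed (use b_lift assms in auto)

lemma S_star_b:
  assumes "e \<in> edges G" "x \<in> X"
  shows "S_star_op e (b x) = (if vert x \<notin> sinks G \<and> edge x = e then b (next_idx x) else 0)"
proof (cases "vert x \<in> sinks G")
  case True
  then have v: "vert x \<noteq> src G e" using src_not_sink assms(1) by metis
  have "S_star_op e (b x) = S_star_op e (P_op {src G e} (b x))"
    using S_star_P assms(1) src_in by simp
  then show ?thesis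
    using True v assms by (simp add: P_b gen_verts.vertex src_in linear_0 linear_ops)
next
  case False
  note * = edge_props(1)[OF assms(2) False] next_props[OF assms(2) False]
  show ?thesis using S_star_lift[OF assms(1) *(1,2,3)] *(4) False by auto
qed

lemma path_sink: "x \<in> X \<Longrightarrow> vert x \<in> sinks G \<Longrightarrow> path x = FinPath [] (vert x)"
proof -
  assume sink: "vert x \<in> sinks G"
  then have "(LEAST n. vert ((next_idx ^^ n) x) \<in> sinks G) = 0" by (intro Least_eq_0) simp
  moreover have "\<exists>n. vert ((next_idx ^^ n) x) \<in> sinks G" using sink by (intro exI[of _ 0]) simp
  ultimately show ?thesis by (simp add: T_map_def)
qed

text \<open>Passing to the next index shifts all iterates by one, hence also the first time at which a sink
  is reached.\<close>
lemma path_cons: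
  assumes "x \<in> X" "vert x \<notin> sinks G" shows "path x = cons_path (edge x) (path (next_idx x))"
proof -
  have Suc: "(next_idx ^^ Suc n) x = (next_idx ^^ n) (next_idx x)" for n
    by (simp add: funpow_Suc_right del: funpow.simps)
  have ex: "(\<exists>n. vert ((next_idx ^^ n) x) \<in> sinks G) \<longleftrightarrow>
      (\<exists>n. vert ((next_idx ^^ n) (next_idx x)) \<in> sinks G)"
    using assms by (metis Suc funpow_0 not0_implies_Suc)
  show ?thesis
  proof (cases "\<exists>n. vert ((next_idx ^^ n) x) \<in> sinks G")
    case True
    let ?n = "LEAST n. vert ((next_idx ^^ n) (next_idx x)) \<in> sinks G"
    obtain n where "vert ((next_idx ^^ n) x) \<in> sinks G" using True by blast
    then have "(LEAST n. vert ((next_idx ^^ n) x) \<in> sinks G) = Suc ?n"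
      using Least_Suc[of "\<lambda>n. vert ((next_idx ^^ n) x) \<in> sinks G" n] assms by (simp add: Suc del: funpow.simps(2))
    moreover have "map (\<lambda>i. edge ((next_idx ^^ i) x)) [0..<Suc ?n] =
        edge x # map (\<lambda>i. edge ((next_idx ^^ i) (next_idx x))) [0..<?n]"
      by (simp add: upt_conv_Cons map_Suc_upt[symmetric] Suc comp_def del: upt_Suc funpow.simps(2))
    ultimately show ?thesis using True ex
      by (simp add: T_map_def Let_def Suc del: funpow.simps(2) upt_Suc)
  next
    case False
    have "(\<lambda>i. edge ((next_idx ^^ i) x)) =
        case_nat (edge x) (\<lambda>i. edge ((next_idx ^^ i) (next_idx x)))"
      by (auto simp: Suc fun_eq_iff simp del: funpow.simps(2) split: nat.splits)
    then show ?thesis using False ex by (simp add: T_map_def)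
  qed
qed

sublocale branching_representation G X vert edge next_idx lift_idx path scale b P_op S_op S_star_op
proof (intro branching_representation.intro branching_representation_axioms.intro)
  show "branching_system G X vert edge next_idx lift_idx path"
    by unfold_locales (fact vert_in edge_props next_props lift_in lift_not_sink edge_lift next_lift
        path_sink path_cons)+
  show "independent (b ` X)" "span (b ` X) = UNIV" using basis_all by (auto simp: is_basis_def)
qed (fact vector_space inj_b linear_ops P_b S_b S_star_b)+

lemma irreducible_representation_iff:
  "irreducible_representation G scale \<psi> \<longleftrightarrow> irreducible"
proof -
  have "subspace N \<and> (\<forall>x\<in>lpa G. \<psi> x ` N \<subseteq> N) \<longleftrightarrow> invariant N" for N
    unfolding invariant_def by (rule conj_cong[OF refl invariant_iff_generators])
  then show ?thesis unfolding irreducible_representation_def irreducible_def by (simp only:)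
qed

end


section \<open>The criterion\<close>

theorem theorem6p9:
  fixes G :: "('v, 'e) pre_ultragraph"
    and scale :: "'r::field \<Rightarrow> 'm::ab_group_add \<Rightarrow> 'm"
    and \<psi> :: "('v, 'e, 'r) lpa_elem \<Rightarrow> 'm \<Rightarrow> 'm"
    and Be :: "'e \<Rightarrow> 'm set" and Bs :: "'v \<Rightarrow> 'm set"
    and X :: "'x set" and b :: "'x \<Rightarrow> 'm"
  assumes "ultragraph G"
    and "vector_space scale"
    and "lpa_representation G scale \<psi>"
    and "perfect_representation G scale \<psi>"
    and "permutative_bases G scale \<psi> Be Bs"
    and "bij_betw b X (B_set G Be Bs (verts G))"
  shows "irreducible_representation G scale \<psi> \<longleftrightarrow>
    (\<exists>p\<in>upaths G.
       Vector_Spaces.linear scale pm_scale (Phi G scale \<psi> Be Bs X b) \<and>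
       bij_betw (Phi G scale \<psi> Be Bs X b) UNIV (path_module G p))"
proof -
  interpret permutative_rep G scale \<psi> Be Bs X b
    using assms by (simp add: permutative_rep_def permutative_rep_axioms_def lpa_rep_def)
  note Phi = Phi_determined[OF assms(2) inj_b indep_b, where G = G and \<psi> = \<psi> and Be = Be and Bs = Bs]
  show ?thesis
    using irreducible_representation_iff irreducible_iff_Phi_iso[OF Phi] Phi(1) by simp
qed

end
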